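(* Let $K\subset\mathbb{R}^2$ be a compact convex set, symmetric with respect to the origin, whose boundary is smooth and has everywhere non-vanishing curvature. Then there exists a constant $C$ depending only on $K$ such that, whenever $A\subset\mathbb{R}^2$ is a set such that $$\int_K e^{2\pi i\langle x,\,a-a'\rangle}\,dx=0\qquad\text{for all } a,a'\in A \text{ with } a\neq a',$$ one has $$\#\bigl(A\cap[-q,q]^2\bigr)\leq Cq\qquad\text{for every } q\geq 1.$$ In particular, $K$ does not have an orthogonal basis of exponentials, i.e. there is no set $A\subset\mathbb{R}^2$ such that $\{e^{2\pi i\langle x,a\rangle}\}_{a\in A}$ is an orthogonal basis of $L^2(K)$.
   Context: $\langle\cdot,\cdot\rangle$ denotes the Euclidean inner product on $\mathbb{R}^2$, and $\#$ denotes cardinality. *)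

theory Defs
  imports "HOL-Analysis.Analysis"
begin

subsection \<open>Smooth plane curves and their curvature\<close>

definition vderiv :: "nat \<Rightarrow> (real \<Rightarrow> real^2) \<Rightarrow> real \<Rightarrow> real^2" where
  "vderiv n \<gamma> = ((\<lambda>f t. vector_derivative f (at t)) ^^ n) \<gamma>"

text \<open>\<open>C\<^sup>\<infinity>\<close> on \<open>I\<close>; only meaningful for open \<open>I\<close>, since \<^const>\<open>vderiv\<close> uses the
  unrestricted filter \<^term>\<open>at t\<close>.\<close>

definition C_infinity_on :: "real set \<Rightarrow> (real \<Rightarrow> real^2) \<Rightarrow> bool" where
  "C_infinity_on I \<gamma> \<longleftrightarrow> (\<forall>n. vderiv n \<gamma> differentiable_on I)"

definition local_param :: "(real^2) set \<Rightarrow> real set \<Rightarrow> (real \<Rightarrow> real^2) \<Rightarrow> bool" where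
  "local_param S I \<gamma> \<longleftrightarrow>
     open I \<and> is_interval I \<and> C_infinity_on I \<gamma> \<and> (\<forall>t\<in>I. vderiv 1 \<gamma> t \<noteq> 0) \<and>
     openin (top_of_set S) (\<gamma> ` I) \<and> (\<exists>g. homeomorphism I (\<gamma> ` I) \<gamma> g)"

text \<open>Embedded one-dimensional \<open>C\<^sup>\<infinity>\<close> submanifold of the plane, without boundary points.\<close>

definition smooth_plane_curve :: "(real^2) set \<Rightarrow> bool" where
  "smooth_plane_curve S \<longleftrightarrow> (\<forall>p\<in>S. \<exists>I \<gamma>. local_param S I \<gamma> \<and> p \<in> \<gamma> ` I)"

definition curvature :: "(real \<Rightarrow> real^2) \<Rightarrow> real \<Rightarrow> real" where
  "curvature \<gamma> t =
     (vderiv 1 \<gamma> t $ 1 * vderiv 2 \<gamma> t $ 2 - vderiv 1 \<gamma> t $ 2 * vderiv 2 \<gamma> t $ 1)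
       / norm (vderiv 1 \<gamma> t) ^ 3"

text \<open>Up to sign, the curvature at a point does not depend on the parametrization, so
  quantifying over all of them is the same as picking one around each point.\<close>

definition nonvanishing_curvature :: "(real^2) set \<Rightarrow> bool" where
  "nonvanishing_curvature S \<longleftrightarrow>
     (\<forall>I \<gamma>. local_param S I \<gamma> \<longrightarrow> (\<forall>t\<in>I. curvature \<gamma> t \<noteq> 0))"

subsection \<open>Orthogonal bases of complex \<open>L\<^sup>2\<close>\<close>

text \<open>Elements of \<open>L\<^sup>2\<close> are represented by functions rather than by classes modulo
  almost-everywhere equality.\<close>

definition L2_space :: "'a measure \<Rightarrow> ('a \<Rightarrow> complex) set" where
  "L2_space M = {f \<in> borel_measurable M. integrable M (\<lambda>x. (cmod (f x))\<^sup>2)}"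

definition L2_inner :: "'a measure \<Rightarrow> ('a \<Rightarrow> complex) \<Rightarrow> ('a \<Rightarrow> complex) \<Rightarrow> complex" where
  "L2_inner M f g = (LINT x|M. f x * cnj (g x))"

definition L2_norm :: "'a measure \<Rightarrow> ('a \<Rightarrow> complex) \<Rightarrow> real" where
  "L2_norm M f = sqrt (LINT x|M. (cmod (f x))\<^sup>2)"

text \<open>A family of pairwise orthogonal, non-null elements whose finite linear combinations
  are dense.\<close>

definition orthogonal_basis_L2 :: "'a measure \<Rightarrow> 'i set \<Rightarrow> ('i \<Rightarrow> 'a \<Rightarrow> complex) \<Rightarrow> bool" where
  "orthogonal_basis_L2 M A e \<longleftrightarrow>
     (\<forall>a\<in>A. e a \<in> L2_space M \<and> L2_norm M (e a) \<noteq> 0) \<and>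
     (\<forall>a\<in>A. \<forall>b\<in>A. a \<noteq> b \<longrightarrow> L2_inner M (e a) (e b) = 0) \<and>
     (\<forall>f\<in>L2_space M. \<forall>\<epsilon>>0. \<exists>F c. finite F \<and> F \<subseteq> A \<and>
        L2_norm M (\<lambda>x. f x - (\<Sum>a\<in>F. c a * e a x)) < \<epsilon>)"

definition exponential :: "real^2 \<Rightarrow> real^2 \<Rightarrow> complex" where
  "exponential a x = exp (2 * of_real pi * \<i> * of_real (x \<bullet> a))"

end

theory Submission
  imports Defs
begin

text \<open>
  Write \<open>E v\<close> for the integral of \<open>exponential v\<close> over \<open>K\<close>, so that the hypothesis on \<open>A\<close> says that
  \<open>E\<close> vanishes on all differences of distinct points of \<open>A\<close>. The zeros of \<open>E\<close> in nearly vertical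
  directions are rigid, and this alone forces linear growth.

  Let \<open>p = (x0, h)\<close> be the highest point of \<open>K\<close>. The boundary is curved at \<open>p\<close>, so the upper boundary
  function \<open>crest\<close> of \<open>K\<close> looks like \<open>h - \<kappa> (x - x0)\<^sup>2 / 2\<close> near \<open>x0\<close>, with \<open>\<kappa> > 0\<close>
  (\<open>curved_top\<close>). Integrating along vertical slices and using the symmetry of \<open>K\<close>, the number
  \<open>E (s, t)\<close> is a nonzero multiple of the integral of \<open>sin (2 \<pi> s x + 2 \<pi> t crest x)\<close>
  (\<open>cosine_transform_eq\<close>). Stationary phase (\<open>concave_stationary_phase\<close>) shows that for bounded \<open>s\<close>
  and large \<open>t\<close> this integral is proportional, up to a small error, to
  \<open>X sin \<alpha> - Y cos \<alpha>\<close> with \<open>\<alpha> = 2 \<pi> (s x0 + t h)\<close>, where \<open>X\<close> and \<open>Y\<close> are truncated Fresnel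
  integrals of \<open>cos (u\<^sup>2)\<close> and \<open>sin (u\<^sup>2)\<close>. Outside a small neighbourhood of \<open>x0\<close> the concavity of \<open>crest\<close>
  replaces smoothness: van der Corput's estimate needs only a monotone derivative.

  The phase \<open>\<alpha>\<close> is linear in \<open>(s, t)\<close>. If \<open>v\<close>, \<open>w\<close> and \<open>v + w\<close> are all zeros of this kind, then
  \<open>X sin - Y cos\<close> nearly vanishes at \<open>\<alpha>\<close>, \<open>\<beta>\<close> and \<open>\<alpha> + \<beta>\<close>, which is only possible
  if \<open>Y\<close> itself nearly vanishes (\<open>no_additive_triple\<close>); but \<open>Y\<close> is bounded below
  (\<open>fresnel_sine_lower\<close>). Hence a vertical strip of width \<open>1\<close> never contains three points of \<open>A\<close> whose
  consecutive heights differ by a large constant \<open>R\<close>, that is, its points lie in two windows of height \<open>R\<close>.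
  Since \<open>E\<close> does not vanish near the origin, \<open>A\<close> is separated, each window holds boundedly many
  points, and the square of half side \<open>q\<close> is covered by about \<open>2 q\<close> strips (\<open>linear_growth\<close>).

  For the second claim, let \<open>A\<close> be the frequency set of an orthogonal basis. As \<open>A\<close> has only linear
  growth, there are points \<open>\<xi>\<close> arbitrarily far from \<open>A\<close> (\<open>hole_in_sparse_set\<close>).
  Integration along lines gives \<open>E v = O(1 / \<bar>v\<bar>)\<close>, so by dyadic summation the sum of
  \<open>\<bar>E (\<xi> - a)\<bar>\<^sup>2\<close> over \<open>a\<close> in \<open>A\<close> is as small as desired
  (\<open>sparse_inverse_square_sum\<close>). By Bessel's inequality (\<open>approximation_error\<close>) the function
  \<open>exponential \<xi>\<close> then stays away from the span of the exponentials with frequencies in \<open>A\<close>.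
\<close>

section \<open>Oscillatory integrals with a concave phase\<close>

text \<open>
  Write \<open>sin \<phi> = (1 / \<phi>') \<cdot> (\<phi>' sin \<phi>)\<close>. The first factor is monotone and bounded by
  \<open>1 / m\<close>, the second has the bounded primitive \<open>- cos \<phi>\<close>, so the second mean value theorem applies.
\<close>
lemma oscillatory_integral_C1_bound:
  fixes \<phi> \<phi>' :: "real \<Rightarrow> real"
  assumes "a \<le> b" "m > 0"
    and deriv: "\<And>x. x \<in> {a..b} \<Longrightarrow> (\<phi> has_real_derivative \<phi>' x) (at x within {a..b})"
    and anti: "\<And>x y. \<lbrakk>a \<le> x; x \<le> y; y \<le> b\<rbrakk> \<Longrightarrow> \<phi>' y \<le> \<phi>' x"
    and steep: "\<phi>' a \<le> - m"
  shows "\<bar>integral {a..b} (\<lambda>x. sin (\<phi> x))\<bar> \<le> 4 / m"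
proof -
  have neg: "\<phi>' x \<le> - m" if "x \<in> {a..b}" for x
    using anti[of a x] steep that by force
  have ftc: "((\<lambda>x. \<phi>' x * sin (\<phi> x)) has_integral (cos (\<phi> u) - cos (\<phi> v))) {u..v}"
    if "a \<le> u" "u \<le> v" "v \<le> b" for u v
  proof -
    have "((\<lambda>x. - cos (\<phi> x)) has_real_derivative \<phi>' x * sin (\<phi> x)) (at x within {u..v})"
      if "x \<in> {u..v}" for x
    proof -
      have "(\<phi> has_real_derivative \<phi>' x) (at x within {u..v})"
        using deriv[of x] that \<open>a \<le> u\<close> \<open>v \<le> b\<close> by (auto intro: DERIV_subset)
      then show ?thesis by (auto intro!: derivative_eq_intros)
    qed
    then have "((\<lambda>x. \<phi>' x * sin (\<phi> x)) has_integral (- cos (\<phi> v) - (- cos (\<phi> u)))) {u..v}"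
      using \<open>u \<le> v\<close> fundamental_theorem_of_calculus[of u v "\<lambda>x. - cos (\<phi> x)" "\<lambda>x. \<phi>' x * sin (\<phi> x)"]
      by (simp add: has_real_derivative_iff_has_vector_derivative)
    then show ?thesis by simp
  qed
  have mono: "1 / \<phi>' x \<le> 1 / \<phi>' y" if "a \<le> x" "x \<le> y" "y \<le> b" for x y
  proof -
    have "\<phi>' x < 0" "\<phi>' y < 0" using neg[of x] neg[of y] that \<open>m > 0\<close> by auto
    then show ?thesis using anti[OF that] by (simp add: divide_simps)
  qed
  obtain c where c: "c \<in> {a..b}" and eq: "integral {a..b} (\<lambda>x. 1 / \<phi>' x * (\<phi>' x * sin (\<phi> x))) =
      1 / \<phi>' a * integral {a..c} (\<lambda>x. \<phi>' x * sin (\<phi> x)) + 1 / \<phi>' b * integral {c..b} (\<lambda>x. \<phi>' x * sin (\<phi> x))"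
    using second_mean_value_theorem[of "\<lambda>x. \<phi>' x * sin (\<phi> x)" a b "\<lambda>x. 1 / \<phi>' x"]
      ftc[of a b] mono \<open>a \<le> b\<close> by (auto simp: has_integral_integrable)
  have "integral {a..b} (\<lambda>x. 1 / \<phi>' x * (\<phi>' x * sin (\<phi> x))) = integral {a..b} (\<lambda>x. sin (\<phi> x))"
    by (rule integral_cong) (use neg \<open>m > 0\<close> in force)
  moreover have "integral {a..c} (\<lambda>x. \<phi>' x * sin (\<phi> x)) = cos (\<phi> a) - cos (\<phi> c)"
    "integral {c..b} (\<lambda>x. \<phi>' x * sin (\<phi> x)) = cos (\<phi> c) - cos (\<phi> b)"
    using ftc c by auto
  moreover have bnd: "\<bar>1 / \<phi>' x * (cos s - cos t)\<bar> \<le> 2 / m" if "x \<in> {a..b}" for x s t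
  proof -
    have "\<bar>cos s - cos t\<bar> \<le> 2" using cos_ge_minus_one[of s] cos_le_one[of s] cos_ge_minus_one[of t] cos_le_one[of t] by linarith
    moreover have "\<bar>1 / \<phi>' x\<bar> \<le> 1 / m" using neg[OF that] \<open>m > 0\<close> by (auto simp: field_simps abs_if)
    ultimately have "\<bar>1 / \<phi>' x\<bar> * \<bar>cos s - cos t\<bar> \<le> 1 / m * 2"
      using \<open>m > 0\<close> by (intro mult_mono) auto
    then show ?thesis by (simp add: abs_mult)
  qed
  ultimately have "integral {a..b} (\<lambda>x. sin (\<phi> x)) = 1 / \<phi>' a * (cos (\<phi> a) - cos (\<phi> c)) + 1 / \<phi>' b * (cos (\<phi> c) - cos (\<phi> b))"
    using eq by simp
  also have "\<bar>\<dots>\<bar> \<le> 2 / m + 2 / m"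
    using bnd[of a "\<phi> a" "\<phi> c"] bnd[of b "\<phi> c" "\<phi> b"] \<open>a \<le> b\<close> by (intro order_trans[OF abs_triangle_ineq] add_mono) auto
  finally show ?thesis by simp
qed

lemma abs_sin_diff_le: "\<bar>sin x - sin y\<bar> \<le> \<bar>x - y\<bar>" for x y :: real
proof -
  have "sin x - sin y = 2 * sin ((x - y) / 2) * cos ((x + y) / 2)"
    by (rule sin_diff_sin)
  then have "\<bar>sin x - sin y\<bar> = 2 * (\<bar>sin ((x - y) / 2)\<bar> * \<bar>cos ((x + y) / 2)\<bar>)"
    by (simp add: abs_mult)
  also have "\<dots> \<le> 2 * (\<bar>(x - y) / 2\<bar> * 1)"
    by (intro mult_left_mono mult_mono abs_sin_x_le_abs_x) auto
  finally show ?thesis by simp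
qed

lemma concave_increment_antimono:
  fixes \<phi> :: "real \<Rightarrow> real"
  assumes "concave_on S \<phi>" "x \<le> y" "t \<ge> 0" "x \<in> S" "y + t \<in> S"
  shows "\<phi> (y + t) - \<phi> y \<le> \<phi> (x + t) - \<phi> x"
proof (cases "x = y \<or> t = 0")
  case True then show ?thesis by auto
next
  case False
  then have pos: "y - x + t > 0" "x < y" "t > 0" using assms by auto
  define u where "u = t / (y - x + t)"
  have u: "0 \<le> u" "0 \<le> 1 - u" using pos by (auto simp: u_def field_simps)
  have ut: "u * (y - x + t) = t" using pos by (simp add: u_def)
  have cc: "v * \<phi> x + w * \<phi> (y + t) \<le> \<phi> (v * x + w * (y + t))" if "v \<ge> 0" "w \<ge> 0" "v + w = 1" for v w
    using assms that unfolding concave_on_iff by auto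
  have e1: "u * x + (1 - u) * (y + t) = y" and e2: "(1 - u) * x + u * (y + t) = x + t"
    using ut by (simp_all add: algebra_simps)
  have "u * \<phi> x + (1 - u) * \<phi> (y + t) \<le> \<phi> y" "(1 - u) * \<phi> x + u * \<phi> (y + t) \<le> \<phi> (x + t)"
    using cc[of u "1 - u"] cc[of "1 - u" u] u e1 e2 by simp_all
  then show ?thesis
    by (simp add: algebra_simps)
qed

text \<open>
  A concave phase is differentiable only off a countable set, so the estimate is applied to the averages
  \<open>\<psi> x\<close> of \<open>\<phi>\<close> over \<open>[x, x + \<tau>]\<close>. They are continuously differentiable, their derivatives
  \<open>(\<phi> (x + \<tau>) - \<phi> x) / \<tau>\<close> inherit monotonicity and steepness from \<open>\<phi>\<close>, and they converge to
  \<open>\<phi>\<close> uniformly as \<open>\<tau>\<close> tends to \<open>0\<close>.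
\<close>
lemma van_der_corput_concave:
  fixes \<phi> :: "real \<Rightarrow> real"
  assumes conc: "concave_on {c<..<d} \<phi>" and ab: "c < a" "a \<le> b" "b < d" and "m > 0"
    and steep: "\<And>x y. \<lbrakk>a \<le> x; x < y; y < d\<rbrakk> \<Longrightarrow> \<phi> y - \<phi> x \<le> - m * (y - x)"
  shows "\<bar>integral {a..b} (\<lambda>x. sin (\<phi> x))\<bar> \<le> 4 / m"
proof (rule field_le_epsilon)
  fix e :: real assume "e > 0"
  define d' where "d' = (b + d) / 2"
  have d': "b < d'" "d' < d" using ab by (auto simp: d'_def)
  have cont: "continuous_on {c<..<d} \<phi>"
    using convex_on_continuous[of "{c<..<d}" "\<lambda>x. - \<phi> x"] conc continuous_on_minus[of "{c<..<d}" "\<lambda>x. - \<phi> x"]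
    by (simp add: concave_on_def)
  then have contd': "continuous_on {a..d'} \<phi>"
    using ab d' by (elim continuous_on_subset) auto
  define \<epsilon> where "\<epsilon> = e / (b - a + 1)"
  have "\<epsilon> > 0" using \<open>e > 0\<close> ab by (simp add: \<epsilon>_def)
  have "uniformly_continuous_on {a..d'} \<phi>"
    using contd' compact_uniformly_continuous by blast
  then obtain \<delta> where "\<delta> > 0" and \<delta>: "\<And>x y. \<lbrakk>x \<in> {a..d'}; y \<in> {a..d'}; \<bar>y - x\<bar> < \<delta>\<rbrakk> \<Longrightarrow> \<bar>\<phi> y - \<phi> x\<bar> < \<epsilon>"
    using \<open>\<epsilon> > 0\<close> unfolding uniformly_continuous_on_def dist_real_def by metis
  define \<tau> where "\<tau> = min (\<delta> / 2) (d' - b)"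
  have \<tau>: "\<tau> > 0" "\<tau> < \<delta>" "b + \<tau> \<le> d'" using \<open>\<delta> > 0\<close> d' by (auto simp: \<tau>_def)
  define \<Phi> where "\<Phi> = (\<lambda>x. integral {a..x} \<phi>)"
  define \<psi> where "\<psi> = (\<lambda>x. (\<Phi> (x + \<tau>) - \<Phi> x) / \<tau>)"
  have \<Phi>: "(\<Phi> has_real_derivative \<phi> x) (at x within {a..d'})" if "x \<in> {a..d'}" for x
    unfolding \<Phi>_def using integral_has_real_derivative[OF contd' that] .
  have d\<psi>: "(\<psi> has_real_derivative (\<phi> (x + \<tau>) - \<phi> x) / \<tau>) (at x within {a..b})" if "x \<in> {a..b}" for x
  proof -
    have 1: "(\<Phi> has_real_derivative \<phi> x) (at x within {a..b})"
      using \<Phi>[of x] that d' by (auto intro: DERIV_subset)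
    have "(\<Phi> has_real_derivative \<phi> (x + \<tau>)) (at (x + \<tau>) within (\<lambda>x. x + \<tau>) ` {a..b})"
      using \<Phi>[of "x + \<tau>"] that \<tau> by (intro DERIV_subset[OF \<Phi>]) auto
    moreover have "((\<lambda>x. x + \<tau>) has_real_derivative 1) (at x within {a..b})"
      by (auto intro!: derivative_eq_intros)
    ultimately have 2: "((\<lambda>x. \<Phi> (x + \<tau>)) has_real_derivative \<phi> (x + \<tau>)) (at x within {a..b})"
      using DERIV_image_chain[of \<Phi> "\<phi> (x + \<tau>)" "\<lambda>x. x + \<tau>" x "{a..b}" 1]
      unfolding o_def by (simp only: mult_1_right)
    show ?thesis unfolding \<psi>_def
      using \<tau> by (auto intro!: derivative_eq_intros 1 2 simp: field_simps)
  qed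
  have close: "\<bar>\<psi> x - \<phi> x\<bar> \<le> \<epsilon>" if "x \<in> {a..b}" for x
  proof -
    have "\<exists>z\<in>{x..x + \<tau>}. \<Phi> (x + \<tau>) - \<Phi> x = \<phi> z * (x + \<tau> - x)"
    proof (rule mvt_very_simple)
      show "x \<le> x + \<tau>" using \<tau> by simp
    next
      fix z assume "x \<le> z" "z \<le> x + \<tau>"
      then have "(\<Phi> has_real_derivative \<phi> z) (at z within {x..x + \<tau>})"
        using that \<tau> by (intro DERIV_subset[OF \<Phi>]) auto
      then show "(\<Phi> has_derivative (*) (\<phi> z)) (at z within {x..x + \<tau>})"
        by (simp add: has_field_derivative_def)
    qed
    then obtain z where z: "x \<le> z" "z \<le> x + \<tau>" "\<psi> x = \<phi> z"
      using \<tau> by (auto simp: \<psi>_def)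
    then show ?thesis using \<delta>[of x z] that \<tau> by auto
  qed
  have "\<bar>integral {a..b} (\<lambda>x. sin (\<psi> x))\<bar> \<le> 4 / m"
  proof (rule oscillatory_integral_C1_bound[OF ab(2) \<open>m > 0\<close> d\<psi>])
    fix x y assume xy: "a \<le> x" "x \<le> y" "y \<le> b"
    show "(\<phi> (y + \<tau>) - \<phi> y) / \<tau> \<le> (\<phi> (x + \<tau>) - \<phi> x) / \<tau>"
      using concave_increment_antimono[OF conc xy(2), of \<tau>] xy \<tau> ab d'
      by (intro divide_right_mono) auto
  next
    show "(\<phi> (a + \<tau>) - \<phi> a) / \<tau> \<le> - m"
      using steep[of a "a + \<tau>"] \<tau> ab d' by (auto simp: field_simps)
  qed auto
  moreover have "\<bar>integral {a..b} (\<lambda>x. sin (\<phi> x)) - integral {a..b} (\<lambda>x. sin (\<psi> x))\<bar> \<le> e"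
  proof -
    have i1: "(\<lambda>x. sin (\<phi> x)) integrable_on {a..b}"
      using contd' d' by (intro integrable_continuous_real continuous_intros) (auto elim!: continuous_on_subset)
    have i2: "(\<lambda>x. sin (\<psi> x)) integrable_on {a..b}"
      using d\<psi> by (intro integrable_continuous_real continuous_intros) (rule DERIV_continuous_on)
    have "integral {a..b} (\<lambda>x. sin (\<phi> x)) - integral {a..b} (\<lambda>x. sin (\<psi> x)) = integral {a..b} (\<lambda>x. sin (\<phi> x) - sin (\<psi> x))"
      using i1 i2 by (simp add: integral_diff)
    also have "norm \<dots> \<le> integral {a..b} (\<lambda>x. \<epsilon>)"
    proof (rule integral_norm_bound_integral)
      show "(\<lambda>x. sin (\<phi> x) - sin (\<psi> x)) integrable_on {a..b}" using i1 i2 by (rule integrable_diff)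
    next
      fix x assume "x \<in> {a..b}"
      have "\<bar>sin (\<phi> x) - sin (\<psi> x)\<bar> \<le> \<bar>\<phi> x - \<psi> x\<bar>"
        by (rule abs_sin_diff_le)
      then show "norm (sin (\<phi> x) - sin (\<psi> x)) \<le> \<epsilon>" using close[OF \<open>x \<in> {a..b}\<close>] by auto
    qed auto
    also have "\<dots> = (b - a) * \<epsilon>" using ab by simp
    also have "\<dots> \<le> e" using \<open>e > 0\<close> ab by (auto simp: \<epsilon>_def field_simps)
    finally show ?thesis by simp
  qed
  ultimately show "\<bar>integral {a..b} (\<lambda>x. sin (\<phi> x))\<bar> \<le> 4 / m + e" by linarith
qed

text \<open>
  A concave function on a closed interval is continuous in the interior but may jump at the endpoints, so
  measurability is settled after splitting these off.
\<close>
lemma integrable_sin_concave: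
  fixes \<phi> :: "real \<Rightarrow> real"
  assumes conc: "concave_on {a..b} \<phi>"
  shows "set_integrable lborel {a..b} (\<lambda>x. sin (\<phi> x))"
    and "(\<lambda>x. sin (\<phi> x)) integrable_on {a..b}"
proof -
  have "concave_on {a<..<b} \<phi>"
    using conc by (auto simp: concave_on_def intro: convex_on_subset)
  then have cont: "continuous_on {a<..<b} \<phi>"
    using convex_on_continuous[of "{a<..<b}" "\<lambda>x. - \<phi> x"] continuous_on_minus[of "{a<..<b}" "\<lambda>x. - \<phi> x"]
    by (simp add: concave_on_def)
  have meas: "(\<lambda>x. indicator {a<..<b} x *\<^sub>R sin (\<phi> x)) \<in> borel_measurable borel"
    by (intro borel_measurable_continuous_on_indicator continuous_intros cont) auto
  have "(\<lambda>x. (indicator {a<..<b} x *\<^sub>R sin (\<phi> x)) + (indicator {a} x *\<^sub>R sin (\<phi> a)) + (if a = b then 0 else indicator {b} x *\<^sub>R sin (\<phi> b))) \<in> borel_measurable borel"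
    using meas by measurable
  also have "(\<lambda>x. (indicator {a<..<b} x *\<^sub>R sin (\<phi> x)) + (indicator {a} x *\<^sub>R sin (\<phi> a)) + (if a = b then 0 else indicator {b} x *\<^sub>R sin (\<phi> b))) =
     (\<lambda>x. indicator {a..b} x *\<^sub>R sin (\<phi> x))" if "a \<le> b"
    using that by (auto simp: fun_eq_iff indicator_def)
  finally have "(\<lambda>x. indicator {a..b} x *\<^sub>R sin (\<phi> x)) \<in> borel_measurable borel" if "a \<le> b"
    using that by blast
  then have meas': "(\<lambda>x. indicator {a..b} x *\<^sub>R sin (\<phi> x)) \<in> borel_measurable borel"
    by (cases "a \<le> b") auto
  show 1: "set_integrable lborel {a..b} (\<lambda>x. sin (\<phi> x))"
    unfolding set_integrable_def
  proof (rule integrableI_bounded_set[of "{a..b}" _ _ 1])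
    show "emeasure lborel {a..b} < \<infinity>" using emeasure_lborel_cbox_finite[of a b] by simp
    show "AE x in lborel. x \<in> {a..b} \<longrightarrow> norm (indicator {a..b} x *\<^sub>R sin (\<phi> x)) \<le> 1" by auto
  qed (use meas' in auto)
  then show "(\<lambda>x. sin (\<phi> x)) integrable_on {a..b}"
    by (rule set_borel_integral_eq_integral)
qed

text \<open>
  The estimate on a closed interval, where \<open>\<phi>\<close> may be discontinuous at the endpoints: cut off end pieces
  of length \<open>\<tau>\<close>, which contribute at most \<open>2 \<tau>\<close>.
\<close>
lemma van_der_corput_decreasing:
  fixes \<phi> :: "real \<Rightarrow> real"
  assumes conc: "concave_on {a..b} \<phi>" and "m > 0"
    and steep: "\<And>x y. \<lbrakk>a \<le> x; x < y; y \<le> b\<rbrakk> \<Longrightarrow> \<phi> y - \<phi> x \<le> - m * (y - x)"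
  shows "\<bar>integral {a..b} (\<lambda>x. sin (\<phi> x))\<bar> \<le> 4 / m"
proof (cases "a < b")
  case False
  then have "integral {a..b} (\<lambda>x. sin (\<phi> x)) = 0" by (cases "a = b") auto
  then show ?thesis using \<open>m > 0\<close> by simp
next
  case True
  show ?thesis
  proof (rule field_le_epsilon)
    fix e :: real assume "e > 0"
    define \<tau> where "\<tau> = min (e / 2) ((b - a) / 2)"
    have \<tau>: "\<tau> > 0" "2 * \<tau> \<le> e" "a + \<tau> \<le> b - \<tau>" using True \<open>e > 0\<close> by (auto simp: \<tau>_def min_def field_simps)
    let ?f = "\<lambda>x. sin (\<phi> x)"
    have int: "?f integrable_on {a..b}" using integrable_sin_concave[OF conc] by auto
    have sub: "?f integrable_on {u..v}" if "a \<le> u" "v \<le> b" for u v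
      using int that by (rule_tac integrable_subinterval_real[OF int]) auto
    have small: "\<bar>integral {u..u + \<tau>} ?f\<bar> \<le> \<tau>" if "a \<le> u" "u + \<tau> \<le> b" for u
      using integral_norm_bound_integral[of ?f "{u..u + \<tau>}" "\<lambda>_. 1"] sub[OF that] \<tau> by auto
    have "integral {a..b} ?f = integral {a..a + \<tau>} ?f + integral {a + \<tau>..b} ?f"
      using \<tau> int by (intro Henstock_Kurzweil_Integration.integral_combine[symmetric]) auto
    moreover have "integral {a + \<tau>..b} ?f = integral {a + \<tau>..b - \<tau>} ?f + integral {b - \<tau>..b} ?f"
      using \<tau> sub by (intro Henstock_Kurzweil_Integration.integral_combine[symmetric]) auto
    moreover have "\<bar>integral {a..a + \<tau>} ?f\<bar> \<le> \<tau>" "\<bar>integral {b - \<tau>..b} ?f\<bar> \<le> \<tau>"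
      using small[of a] small[of "b - \<tau>"] \<tau> by auto
    moreover have "\<bar>integral {a + \<tau>..b - \<tau>} ?f\<bar> \<le> 4 / m"
    proof (rule van_der_corput_concave[of a b])
      show "concave_on {a<..<b} \<phi>" using conc by (auto simp: concave_on_def intro: convex_on_subset)
    qed (use \<tau> \<open>m > 0\<close> steep in auto)
    ultimately show "\<bar>integral {a..b} ?f\<bar> \<le> 4 / m + e"
      using \<tau>(2) by linarith
  qed
qed

lemma concave_on_reflect:
  fixes \<phi> :: "real \<Rightarrow> real"
  assumes "concave_on {a..b} \<phi>"
  shows "concave_on {-b..-a} (\<lambda>x. \<phi> (- x))"
  unfolding concave_on_iff
proof (intro conjI ballI allI impI)
  fix x y u v :: real assume "x \<in> {-b..-a}" "y \<in> {-b..-a}" "0 \<le> u" "0 \<le> v" "u + v = 1"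
  then have "u * \<phi> (- x) + v * \<phi> (- y) \<le> \<phi> (u *\<^sub>R (- x) + v *\<^sub>R (- y))"
    using assms unfolding concave_on_iff by fastforce
  then show "u * \<phi> (- x) + v * \<phi> (- y) \<le> \<phi> (- (u *\<^sub>R x + v *\<^sub>R y))"
    by (simp add: algebra_simps)
qed auto

lemma van_der_corput_increasing:
  fixes \<phi> :: "real \<Rightarrow> real"
  assumes conc: "concave_on {a..b} \<phi>" and "m > 0"
    and steep: "\<And>x y. \<lbrakk>a \<le> x; x < y; y \<le> b\<rbrakk> \<Longrightarrow> m * (y - x) \<le> \<phi> y - \<phi> x"
  shows "\<bar>integral {a..b} (\<lambda>x. sin (\<phi> x))\<bar> \<le> 4 / m"
proof -
  have "\<bar>integral {-b..-a} (\<lambda>x. sin (\<phi> (- x)))\<bar> \<le> 4 / m"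
  proof (rule van_der_corput_decreasing[OF concave_on_reflect[OF conc] \<open>m > 0\<close>])
    fix x y assume "- b \<le> x" "x < y" "y \<le> - a"
    then show "\<phi> (- y) - \<phi> (- x) \<le> - m * (y - x)"
      using steep[of "- y" "- x"] by (simp add: algebra_simps)
  qed
  then show ?thesis using Henstock_Kurzweil_Integration.integral_reflect_real[of b a "\<lambda>x. sin (\<phi> x)"] by simp
qed

section \<open>Fresnel integrals and sums of phases\<close>

text \<open>
  On \<open>[1, M]\<close> one integrates by parts with the primitive \<open>1 - cos (u\<^sup>2)\<close> of \<open>2 u sin (u\<^sup>2)\<close>. The
  boundary term at \<open>1\<close> costs at most \<open>1/4\<close> and the remaining terms are nonnegative. On \<open>[0, 1]\<close> the bound
  \<open>sin x \<ge> x - x\<^sup>3 / 6\<close> yields \<open>13/42\<close>, which exceeds \<open>1/4\<close>.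
\<close>
lemma fresnel_sine_lower:
  assumes "M \<ge> 1"
  shows "integral {-M..M} (\<lambda>u. sin (u^2 :: real)) \<ge> 1 / 10"
proof -
  let ?s = "\<lambda>u::real. sin (u^2)"
  have int: "?s integrable_on {a..b}" for a b
    by (intro integrable_continuous_real continuous_intros)
  have low: "sin x \<ge> x - x^3 / 6" if "x \<ge> 0" for x :: real
  proof -
    have "\<bar>sin x - x\<bar> \<le> x^3 / 6"
      using Maclaurin_sin_bound[of x 3] that by (simp add: sin_coeff_def fact_numeral eval_nat_numeral)
    then show ?thesis by linarith
  qed
  have "((\<lambda>u::real. u^2 - u^6/6) has_integral (1^3/3 - 1^7/42 - (0^3/3 - 0^7/42))) {0..1}"
    by (rule fundamental_theorem_of_calculus)
       (auto intro!: derivative_eq_intros simp: has_real_derivative_iff_has_vector_derivative[symmetric])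
  then have "integral {0..1} (\<lambda>u::real. u^2 - u^6/6) = 13/42" "(\<lambda>u::real. u^2 - u^6/6) integrable_on {0..1}"
    by (auto simp: integral_unique has_integral_integrable)
  moreover have "integral {0..1} (\<lambda>u::real. u^2 - u^6/6) \<le> integral {0..1} ?s"
  proof (rule integral_le)
    fix u :: real
    show "u^2 - u^6/6 \<le> ?s u" using low[of "u^2"] by (simp flip: power_mult)
  qed (use calculation int in auto)
  moreover have "integral {1..M} ?s \<ge> - 1/4"
  proof -
    let ?F = "\<lambda>u::real. (1 - cos (u^2)) / (2 * u)"
    let ?f = "\<lambda>u::real. ?s u - (1 - cos (u^2)) / (2 * u^2)"
    have "(?f has_integral (?F M - ?F 1)) {1..M}"
    proof (rule fundamental_theorem_of_calculus[OF assms])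
      fix u :: real assume "u \<in> {1..M}"
      then have "(?F has_real_derivative ?f u) (at u within {1..M})"
        by (auto intro!: derivative_eq_intros simp: field_simps power2_eq_square)
      then show "(?F has_vector_derivative ?f u) (at u within {1..M})"
        by (simp add: has_real_derivative_iff_has_vector_derivative)
    qed
    then have i: "integral {1..M} ?f = ?F M - ?F 1" "?f integrable_on {1..M}"
      by (auto simp: integral_unique has_integral_integrable)
    have "integral {1..M} ?f \<le> integral {1..M} ?s"
      by (rule integral_le[OF i(2) int]) auto
    moreover have "?F M \<ge> 0" using assms by auto
    moreover have "?F 1 \<le> 1/4"
    proof -
      have "\<bar>sin (1/2)\<bar> \<le> (1/2 :: real)" using abs_sin_x_le_abs_x[of "1/2"] by simp
      then have "(sin (1/2))\<^sup>2 \<le> ((1/2)\<^sup>2 :: real)" by (metis abs_ge_zero power2_abs power_mono)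
      then show ?thesis using cos_double_sin[of "1/2 :: real"] by (simp add: power2_eq_square)
    qed
    ultimately show ?thesis using i by linarith
  qed
  moreover have "integral {0..M} ?s = integral {0..1} ?s + integral {1..M} ?s"
    using assms int by (intro Henstock_Kurzweil_Integration.integral_combine[symmetric]) auto
  moreover have "integral {-M..M} ?s = integral {-M..0} ?s + integral {0..M} ?s"
    using assms int by (intro Henstock_Kurzweil_Integration.integral_combine[symmetric]) auto
  moreover have "integral {-M..0} ?s = integral {0..M} ?s"
    using Henstock_Kurzweil_Integration.integral_reflect_real[of M 0 ?s] by simp
  ultimately show ?thesis by linarith
qed

text \<open>
  With \<open>X = r cos \<theta>\<close> and \<open>Y = r sin \<theta>\<close> the expression \<open>X sin t - Y cos t\<close> equals
  \<open>r sin (t - \<theta>)\<close>. If it vanishes at \<open>\<alpha>\<close> and \<open>\<beta>\<close>, then \<open>\<alpha> - \<theta>\<close> and \<open>\<beta> - \<theta>\<close>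
  are multiples of \<open>\<pi>\<close>, and at \<open>\<alpha> + \<beta>\<close> it equals \<open>\<plusminus> r sin \<theta> = \<plusminus> Y\<close>. The lemma is the
  quantitative form of this.
\<close>
lemma no_additive_triple:
  fixes X Y \<alpha> \<beta> \<epsilon> :: real
  assumes a: "\<bar>X * sin \<alpha> - Y * cos \<alpha>\<bar> \<le> \<epsilon>" and b: "\<bar>X * sin \<beta> - Y * cos \<beta>\<bar> \<le> \<epsilon>"
    and ab: "\<bar>X * sin (\<alpha> + \<beta>) - Y * cos (\<alpha> + \<beta>)\<bar> \<le> \<epsilon>"
  shows "Y \<le> 5 * \<epsilon>"
proof -
  obtain r \<theta> where \<theta>: "X = r * cos \<theta>" "Y = r * sin \<theta>"
    using polar_Ex[of X Y] by blast
  have S: "X * sin t - Y * cos t = r * sin (t - \<theta>)" for t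
    by (simp add: \<theta> sin_diff algebra_simps)
  define a b where "a = \<alpha> - \<theta>" and "b = \<beta> - \<theta>"
  have le: "\<bar>r * u * v\<bar> \<le> \<epsilon>" if "\<bar>r * u\<bar> \<le> \<epsilon>" "\<bar>v\<bar> \<le> 1" for u v
  proof -
    have "\<bar>r * u\<bar> * \<bar>v\<bar> \<le> \<epsilon> * 1" using that by (intro mult_mono) auto
    then show ?thesis by (simp add: abs_mult)
  qed
  have 1: "\<bar>r * sin a\<bar> \<le> \<epsilon>" "\<bar>r * sin b\<bar> \<le> \<epsilon>" using assms(1,2) by (auto simp: S a_def b_def)
  have "\<bar>r * sin a * cos b\<bar> \<le> \<epsilon>" "\<bar>r * sin b * cos a\<bar> \<le> \<epsilon>"
    using le[OF 1(1), of "cos b"] le[OF 1(2), of "cos a"] by auto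
  then have 2: "\<bar>r * sin (a + b)\<bar> \<le> 2 * \<epsilon>"
    by (simp add: sin_add algebra_simps abs_le_iff)
  have "\<bar>r * sin (a + b + \<theta>)\<bar> \<le> \<epsilon>"
    using ab S[of "\<alpha> + \<beta>"] by (simp add: a_def b_def algebra_simps)
  then have 3: "\<bar>r * sin (a + b) * cos \<theta> + Y * cos (a + b)\<bar> \<le> \<epsilon>"
    unfolding sin_add[of "a + b" \<theta>] by (simp add: \<theta> algebra_simps)
  have 4: "\<bar>r * sin (a + b)\<bar> * \<bar>t\<bar> \<le> 2 * \<epsilon>" if "\<bar>t\<bar> \<le> 1" for t
    using mult_mono[OF 2 that] 2 by auto
  then have "\<bar>Y * cos (a + b)\<bar> \<le> 3 * \<epsilon>"
    using 3 4[of "cos \<theta>", OF abs_cos_le_one] unfolding abs_mult[symmetric] abs_le_iff by linarith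
  moreover have "\<bar>Y\<bar> * (1 - \<bar>sin (a + b)\<bar>) \<le> \<bar>Y * cos (a + b)\<bar>"
  proof -
    have "1 = (sin (a + b))\<^sup>2 + (cos (a + b))\<^sup>2" by simp
    also have "\<dots> \<le> \<bar>sin (a + b)\<bar> + \<bar>cos (a + b)\<bar>"
      by (metis abs_cos_le_one abs_ge_zero abs_sin_le_one add_mono mult_left_le power2_abs power2_eq_square)
    finally show ?thesis by (simp add: abs_mult mult_left_mono)
  qed
  moreover have "\<bar>Y\<bar> * \<bar>sin (a + b)\<bar> \<le> 2 * \<epsilon>"
    using 4[of "sin \<theta>"] by (simp add: \<theta> abs_mult mult_ac)
  ultimately have "\<bar>Y\<bar> \<le> 5 * \<epsilon>" by (simp add: algebra_simps)
  then show ?thesis by simp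
qed

section \<open>Vertical slices of a symmetric convex body\<close>

definition pt :: "real \<Rightarrow> real \<Rightarrow> real^2" where
  "pt x y = x *\<^sub>R axis 1 1 + y *\<^sub>R axis 2 1"

lemma pt_nth [simp]: "pt x y $ 1 = x" "pt x y $ 2 = y"
  by (simp_all add: pt_def axis_def)

lemma pt_eta [simp]: "pt (v $ 1) (v $ 2) = v"
  by (simp add: vec_eq_iff forall_2)

lemma inner_real2: "v \<bullet> w = v $ 1 * w $ 1 + v $ 2 * w $ 2" for v w :: "real^2"
  by (simp add: inner_vec_def sum_2)

lemma measurable_pt: "(\<lambda>z. pt (fst z) (snd z)) \<in> borel_measurable (lborel \<Otimes>\<^sub>M lborel)"
proof -
  have "(\<lambda>z. pt (fst z) (snd z)) \<in> borel_measurable borel"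
    unfolding pt_def by (intro borel_measurable_continuous_onI continuous_intros)
  then show ?thesis by (simp add: lborel_prod)
qed

lemma lborel_plane: "distr (lborel \<Otimes>\<^sub>M lborel) borel (\<lambda>z. pt (fst z) (snd z)) = lborel"
proof (rule lborel_eqI[symmetric])
  note meas = measurable_pt
  fix l u :: "real^2" assume le: "\<And>b. b \<in> Basis \<Longrightarrow> l \<bullet> b \<le> u \<bullet> b"
  then have lu: "l $ i \<le> u $ i" for i using le[of "axis i 1"] by (simp add: inner_axis axis_in_Basis_iff)
  have "emeasure (distr (lborel \<Otimes>\<^sub>M lborel) borel (\<lambda>z. pt (fst z) (snd z))) (box l u)
      = emeasure (lborel \<Otimes>\<^sub>M lborel) ((\<lambda>z. pt (fst z) (snd z)) -` box l u \<inter> space (lborel \<Otimes>\<^sub>M lborel))"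
    by (rule emeasure_distr[OF meas]) auto
  also have "(\<lambda>z. pt (fst z) (snd z)) -` box l u \<inter> space (lborel \<Otimes>\<^sub>M lborel)
      = {l $ 1<..<u $ 1} \<times> {l $ 2<..<u $ 2}"
    by (auto simp: mem_box_cart forall_2 space_pair_measure)
  also have "emeasure (lborel \<Otimes>\<^sub>M lborel) \<dots> = ennreal ((u $ 1 - l $ 1) * (u $ 2 - l $ 2))"
    using lu by (subst lborel.emeasure_pair_measure_Times) (auto simp: ennreal_mult)
  also have "(u $ 1 - l $ 1) * (u $ 2 - l $ 2) = (\<Prod>b\<in>Basis. (u - l) \<bullet> b)"
  proof -
    have "(Basis :: (real^2) set) = {axis 1 1, axis 2 1}"
      by (auto simp: Basis_vec_def UNIV_2)
    then have "(\<Prod>b\<in>Basis. (u - l) \<bullet> b) = (\<Prod>b\<in>{axis 1 1, axis 2 1}. (u - l) \<bullet> b)"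
      by (rule arg_cong)
    then show ?thesis by (simp add: inner_axis axis_eq_axis)
  qed
  finally show "emeasure (distr (lborel \<Otimes>\<^sub>M lborel) borel (\<lambda>z. pt (fst z) (snd z))) (box l u)
      = ennreal (\<Prod>b\<in>Basis. (u - l) \<bullet> b)" .
qed simp

lemma integral_plane_slices:
  fixes f :: "real^2 \<Rightarrow> 'b::euclidean_space"
  assumes K: "compact K" and f: "continuous_on K f"
  shows "(LINT v|lebesgue_on K. f v) = (LINT x|lborel. LINT y|lborel. indicator K (pt x y) *\<^sub>R f (pt x y))"
    and "(LINT v|lebesgue_on K. f v) = (LINT y|lborel. LINT x|lborel. indicator K (pt x y) *\<^sub>R f (pt x y))"
    and "integrable (lebesgue_on K) f"
proof -
  let ?F = "\<lambda>v. indicator K v *\<^sub>R f v"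
  have int: "integrable lborel ?F" using borel_integrable_compact[OF K f] .
  have Kleb: "K \<in> sets lebesgue" using K by (simp add: compact_imp_closed borel_closed)
  show "integrable (lebesgue_on K) f"
    using int Kleb by (simp add: integrable_restrict_space integrable_completion)
  note meas = measurable_pt
  have Fm: "?F \<in> borel_measurable borel" using int by simp
  have int': "integrable (lborel \<Otimes>\<^sub>M lborel) (\<lambda>z. ?F (pt (fst z) (snd z)))"
    using int by (subst (asm) lborel_plane[symmetric]) (simp add: integrable_distr_eq meas Fm)
  have "(LINT v|lebesgue_on K. f v) = (LINT v|lebesgue. ?F v)"
    using Kleb by (simp add: integral_restrict_space)
  also have "\<dots> = (LINT v|lborel. ?F v)" using int by (intro integral_completion) simp
  also have "\<dots> = (LINT z|(lborel \<Otimes>\<^sub>M lborel). ?F (pt (fst z) (snd z)))"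
    by (subst lborel_plane[symmetric]) (rule integral_distr[OF meas Fm])
  finally have 1: "(LINT v|lebesgue_on K. f v) = (LINT z|(lborel \<Otimes>\<^sub>M lborel). ?F (pt (fst z) (snd z)))" .
  show "(LINT v|lebesgue_on K. f v) = (LINT x|lborel. LINT y|lborel. indicator K (pt x y) *\<^sub>R f (pt x y))"
    using lborel_pair.integral_fst'[OF int'] 1 by simp
  show "(LINT v|lebesgue_on K. f v) = (LINT y|lborel. LINT x|lborel. indicator K (pt x y) *\<^sub>R f (pt x y))"
    using lborel_pair.integral_snd[of "\<lambda>x y. ?F (pt x y)"] int' 1 by (simp add: case_prod_beta')
qed

lemma integral_cos_interval:
  fixes c \<omega> :: real
  assumes "\<omega> \<noteq> 0" "l \<le> u"
  shows "(LINT y|lborel. indicator {l..u} y * cos (c + \<omega> * y)) = (sin (c + \<omega> * u) - sin (c + \<omega> * l)) / \<omega>"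
proof -
  have "(LINT y|lborel. cos (c + \<omega> * y) * indicator {l..u} y) = sin (c + \<omega> * u) / \<omega> - sin (c + \<omega> * l) / \<omega>"
    using assms by (intro integral_FTC_Icc_real) (auto intro!: derivative_eq_intros continuous_intros)
  then show ?thesis by (simp add: mult.commute diff_divide_distrib)
qed

lemma concave_phase:
  fixes g :: "real \<Rightarrow> real"
  assumes g: "concave_on S g" and "\<omega> \<ge> 0"
  shows "concave_on S (\<lambda>x. c * x + \<omega> * g x)"
  unfolding concave_on_iff
proof (intro conjI ballI allI impI)
  show "convex S" using g by (simp add: concave_on_iff)
  fix x y u v :: real assume *: "x \<in> S" "y \<in> S" "0 \<le> u" "0 \<le> v" "u + v = 1"
  have "u * g x + v * g y \<le> g (u * x + v * y)"
    using g * unfolding concave_on_iff by simp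
  from mult_left_mono[OF this \<open>\<omega> \<ge> 0\<close>]
  show "u * (c * x + \<omega> * g x) + v * (c * y + \<omega> * g y) \<le> c * (u *\<^sub>R x + v *\<^sub>R y) + \<omega> * g (u *\<^sub>R x + v *\<^sub>R y)"
    by (simp add: algebra_simps)
qed

locale symmetric_convex_plane =
  fixes K :: "(real^2) set"
  assumes cpt: "compact K" and cvx: "convex K" and sym: "\<And>v. v \<in> K \<Longrightarrow> - v \<in> K" and ne: "K \<noteq> {}"
begin

definition shadow :: "real set" where "shadow = (\<lambda>v. v $ 1) ` K"
definition slice :: "real \<Rightarrow> real set" where "slice x = {y. pt x y \<in> K}"
text \<open>
  The function whose graph is the upper part of the boundary of \<open>K\<close>; by symmetry the lower part is the
  graph of \<open>\<lambda>x. - crest (- x)\<close>.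
\<close>
definition crest :: "real \<Rightarrow> real" where "crest x = Sup (slice x)"

lemma mem_shadow: "x \<in> shadow \<longleftrightarrow> slice x \<noteq> {}"
  unfolding shadow_def slice_def by (auto, metis pt_eta, metis imageI pt_nth(1))

lemma convex_comb: "\<lbrakk>pt x y \<in> K; pt x' y' \<in> K; 0 \<le> u; 0 \<le> v; u + v = 1\<rbrakk> \<Longrightarrow> pt (u * x + v * x') (u * y + v * y') \<in> K"
  using cvx[unfolded convex_def, rule_format, of "pt x y" "pt x' y'" u v]
  by (simp add: pt_def algebra_simps)

lemma neg_pt: "pt (- x) (- y) = - pt x y"
  by (simp add: pt_def)

lemma sym_pt: "pt x y \<in> K \<longleftrightarrow> pt (- x) (- y) \<in> K"
  using sym[of "pt x y"] sym[of "- pt x y"] by (auto simp: neg_pt)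

lemma compact_slice: "compact (slice x)"
proof -
  have "slice x = (\<lambda>v. v $ 2) ` (K \<inter> {v. v $ 1 = x})"
  proof (intro set_eqI iffI)
    fix y assume "y \<in> slice x"
    then show "y \<in> (\<lambda>v. v $ 2) ` (K \<inter> {v. v $ 1 = x})"
      by (intro image_eqI[of _ _ "pt x y"]) (auto simp: slice_def)
  qed (auto simp: slice_def)
  moreover have "closed {v::real^2. v $ 1 = x}" by (intro closed_Collect_eq continuous_intros)
  ultimately show ?thesis using cpt
    by (auto intro!: compact_continuous_image continuous_intros compact_Int_closed)
qed

lemma slice_le_crest: "y \<in> slice x \<Longrightarrow> y \<le> crest x"
  unfolding crest_def using compact_slice[of x] by (intro cSup_upper) (auto intro: compact_imp_bounded bounded_imp_bdd_above)

lemma crest_mem: "x \<in> shadow \<Longrightarrow> crest x \<in> slice x"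
  unfolding crest_def mem_shadow using compact_slice[of x]
  by (intro closed_contains_Sup) (auto intro: compact_imp_bounded bounded_imp_bdd_above compact_imp_closed)

lemma sym_shadow: "x \<in> shadow \<longleftrightarrow> - x \<in> shadow"
proof -
  have "- x \<in> shadow" if "x \<in> shadow" for x
    using that by (auto simp: shadow_def image_iff) (metis sym vector_uminus_component)
  from this[of x] this[of "- x"] show ?thesis by auto
qed

lemma slice_eq: assumes "x \<in> shadow" shows "slice x = {- crest (- x)..crest x}"
proof
  show "slice x \<subseteq> {- crest (- x)..crest x}"
  proof
    fix y assume y: "y \<in> slice x"
    then have "- y \<in> slice (- x)" using sym_pt[of x y] by (simp add: slice_def)
    then show "y \<in> {- crest (- x)..crest x}" using slice_le_crest[OF y] slice_le_crest by force
  qed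
next
  have a: "pt x (crest x) \<in> K" using crest_mem[OF assms] by (simp add: slice_def)
  have b: "pt x (- crest (- x)) \<in> K" using crest_mem[of "- x"] assms sym_shadow[of x] sym_pt[of x "- crest (- x)"]
    by (simp add: slice_def)
  have "convex (slice x)"
    unfolding convex_def slice_def using convex_comb[of x _ x]
    by (auto simp flip: distrib_right)
  moreover have "crest x \<in> slice x" "- crest (- x) \<in> slice x" using a b by (auto simp: slice_def)
  ultimately show "{- crest (- x)..crest x} \<subseteq> slice x"
    by (metis closed_segment_eq_real_ivl closed_segment_subset atLeastatMost_empty_iff empty_subsetI)
qed

definition halfwidth :: real where "halfwidth = Sup shadow"

lemma shadow_eq: "shadow = {- halfwidth..halfwidth}"
proof -
  have c: "compact shadow" unfolding shadow_def using cpt by (intro compact_continuous_image continuous_intros)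
  have "convex shadow" unfolding shadow_def
    by (rule convex_linear_image[OF _ cvx]) (auto simp: linear_iff)
  then have "connected shadow" by (rule convex_connected)
  then obtain a b where ab: "shadow = {a..b}" using connected_compact_interval_1 c by blast
  moreover have "shadow \<noteq> {}" using ne by (auto simp: shadow_def)
  ultimately have "a \<le> b" by auto
  have "a = - b" using sym_shadow[of a] sym_shadow[of b] ab \<open>a \<le> b\<close> by auto
  then show ?thesis using ab \<open>a \<le> b\<close> by (simp add: halfwidth_def)
qed

lemma crest_concave: "concave_on shadow crest"
  unfolding concave_on_iff
proof (intro conjI ballI allI impI)
  show "convex shadow" by (simp add: shadow_eq)
  fix x y u v :: real assume *: "x \<in> shadow" "y \<in> shadow" "0 \<le> u" "0 \<le> v" "u + v = 1"
  have "pt (u * x + v * y) (u * crest x + v * crest y) \<in> K"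
    using crest_mem[OF *(1)] crest_mem[OF *(2)] * by (intro convex_comb) (auto simp: slice_def)
  then show "u * crest x + v * crest y \<le> crest (u *\<^sub>R x + v *\<^sub>R y)"
    by (intro slice_le_crest) (simp add: slice_def)
qed

text \<open>
  Integrating the cosine over the slice \<open>[- crest (- x), crest x]\<close> leaves two sines, and these become equal
  under the reflection \<open>x \<mapsto> - x\<close>.
\<close>
lemma cosine_transform_eq:
  assumes "t > 0"
  shows "(LINT v|lebesgue_on K. cos (2 * pi * (v \<bullet> pt s t)))
    = 1 / (pi * t) * integral {- halfwidth..halfwidth} (\<lambda>x. sin (2 * pi * s * x + 2 * pi * t * crest x))"
proof -
  define \<omega> where "\<omega> = 2 * pi * t"
  have \<omega>: "\<omega> > 0" using assms by (simp add: \<omega>_def)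
  let ?D = "{- halfwidth..halfwidth}"
  let ?\<phi> = "\<lambda>x. 2 * pi * s * x + \<omega> * crest x"
  have inner: "(LINT y|lborel. indicator K (pt x y) *\<^sub>R cos (2 * pi * (pt x y \<bullet> pt s t)))
      = indicator ?D x *\<^sub>R ((sin (?\<phi> x) + sin (?\<phi> (- x))) / \<omega>)" for x
  proof (cases "x \<in> shadow")
    case False
    then have "indicator K (pt x y) = (0::real)" for y by (auto simp: mem_shadow slice_def)
    then show ?thesis using False by (simp flip: shadow_eq)
  next
    case True
    have "- crest (- x) \<le> crest x" using slice_eq[OF True] crest_mem[OF True] by auto
    have "(LINT y|lborel. indicator K (pt x y) *\<^sub>R cos (2 * pi * (pt x y \<bullet> pt s t)))
      = (LINT y|lborel. indicator {- crest (- x)..crest x} y * cos (2 * pi * s * x + \<omega> * y))"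
      unfolding slice_eq[OF True, symmetric]
      by (intro Bochner_Integration.integral_cong) (auto simp: slice_def indicator_def inner_real2 \<omega>_def algebra_simps)
    also have "\<dots> = (sin (2 * pi * s * x + \<omega> * crest x) - sin (2 * pi * s * x + \<omega> * - crest (- x))) / \<omega>"
      using \<omega> \<open>- crest (- x) \<le> crest x\<close> by (intro integral_cos_interval) auto
    also have "sin (2 * pi * s * x + \<omega> * - crest (- x)) = - sin (?\<phi> (- x))"
      by (simp flip: sin_minus)
    finally show ?thesis using True by (simp add: shadow_eq)
  qed
  have conc: "concave_on ?D ?\<phi>" using concave_phase[OF crest_concave[unfolded shadow_eq], of \<omega>] \<omega> by auto
  note i1 = integrable_sin_concave[OF conc]
  note i2 = integrable_sin_concave[OF concave_on_reflect[OF conc], simplified]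
  have "(LINT v|lebesgue_on K. cos (2 * pi * (v \<bullet> pt s t))) = (LINT x:?D|lborel. (sin (?\<phi> x) + sin (?\<phi> (- x))) / \<omega>)"
    unfolding set_lebesgue_integral_def
    by (subst integral_plane_slices(1)[OF cpt]) (auto intro!: continuous_intros simp only: inner)
  also have "\<dots> = integral ?D (\<lambda>x. (sin (?\<phi> x) + sin (?\<phi> (- x))) / \<omega>)"
    using i1 i2 by (intro set_borel_integral_eq_integral set_integral_divide_zero set_integral_add) auto
  also have "\<dots> = (integral ?D (\<lambda>x. sin (?\<phi> x)) + integral ?D (\<lambda>x. sin (?\<phi> (- x)))) / \<omega>"
    using i1 i2 by (simp add: integral_divide integral_add)
  also have "integral ?D (\<lambda>x. sin (?\<phi> (- x))) = integral ?D (\<lambda>x. sin (?\<phi> x))"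
    using Henstock_Kurzweil_Integration.integral_reflect_real[of halfwidth "- halfwidth" "\<lambda>x. sin (?\<phi> x)"] by simp
  finally show ?thesis using assms by (simp add: \<omega>_def field_simps)
qed

end

section \<open>Stationary phase at a parabolic peak\<close>

lemma concave_chord_slope:
  fixes \<phi> :: "real \<Rightarrow> real"
  assumes conc: "concave_on S \<phi>" and "p \<in> S" "y \<in> S" "p < q" "q \<le> x" "x < y"
  shows "\<phi> y - \<phi> x \<le> (\<phi> q - \<phi> p) / (q - p) * (y - x)"
    and "(\<phi> y - \<phi> x) / (y - x) * (q - p) \<le> \<phi> q - \<phi> p"
proof -
  have cv: "convex_on S (\<lambda>x. - \<phi> x)" using conc by (simp add: concave_on_def)
  have "is_interval S" using conc by (simp add: concave_on_iff is_interval_convex_1)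
  then have x: "x \<in> S" using assms unfolding is_interval_1 by (metis less_imp_le order_trans)
  have neg_slope: "(- \<phi> u - - \<phi> v) / (u - v) = - ((\<phi> v - \<phi> u) / (v - u))" for u v
    by (simp add: minus_divide_right)
  have 1: "(- \<phi> p - - \<phi> q) / (p - q) \<le> (- \<phi> p - - \<phi> x) / (p - x)"
    using convex_on_slope_le(1)[OF cv \<open>p \<in> S\<close> x, of q] assms by (cases "q = x") auto
  also have "\<dots> \<le> (- \<phi> p - - \<phi> y) / (p - y)"
    using convex_on_slope_le(1)[OF cv \<open>p \<in> S\<close> \<open>y \<in> S\<close>, of x] assms by auto
  also have "\<dots> \<le> (- \<phi> x - - \<phi> y) / (x - y)"
    using convex_on_slope_le(2)[OF cv \<open>p \<in> S\<close> \<open>y \<in> S\<close>, of x] assms by auto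
  finally have *: "(\<phi> y - \<phi> x) / (y - x) \<le> (\<phi> q - \<phi> p) / (q - p)"
    by (simp only: neg_slope neg_le_iff_le)
  show "\<phi> y - \<phi> x \<le> (\<phi> q - \<phi> p) / (q - p) * (y - x)"
    using * assms by (simp add: pos_divide_le_eq)
  show "(\<phi> y - \<phi> x) / (y - x) * (q - p) \<le> \<phi> q - \<phi> p"
    using * assms by (simp add: pos_le_divide_eq)
qed

definition parabolic_peak :: "(real \<Rightarrow> real) \<Rightarrow> real \<Rightarrow> real \<Rightarrow> real \<Rightarrow> bool" where
  "parabolic_peak g x0 h \<kappa> \<longleftrightarrow>
     (\<forall>e>0. \<exists>\<eta>>0. \<forall>s. \<bar>s\<bar> \<le> \<eta> \<longrightarrow> \<bar>g (x0 + s) - h + \<kappa> * s^2 / 2\<bar> \<le> e * s^2)"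

text \<open>
  The leading term of stationary phase for the integral of \<open>sin (c x + \<omega> g x)\<close>, uniform in the bounded
  parameter \<open>c\<close>. Put \<open>\<mu> = sqrt (\<kappa> \<omega> / 2)\<close>. On the window \<open>\<bar>x - x0\<bar> \<le> M / \<mu>\<close> the phase is
  \<open>c x0 + \<omega> h - (\<mu> (x - x0))\<^sup>2\<close> up to a small error, and rescaling by \<open>\<mu>\<close> produces the Fresnel
  integrals over \<open>[- M, M]\<close>. Outside the window concavity makes the phase at least as steep as the chord from
  the peak to the end of the window, whose slope has size at least \<open>\<mu> M / 4\<close>; by van der Corput the two
  tails contribute at most \<open>32 / M\<close> after rescaling. Hence \<open>M\<close> is chosen first and then \<open>\<omega>\<close> large.
\<close>
lemma concave_stationary_phase:
  fixes g :: "real \<Rightarrow> real"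
  assumes conc: "concave_on {a..b} g" and x0: "a < x0" "x0 < b" and "\<kappa> > 0" and "\<epsilon> > 0" and "L \<ge> 0"
    and peano: "parabolic_peak g x0 h \<kappa>"
  obtains M \<Lambda> where "M \<ge> 1" "\<Lambda> > 0"
    "\<And>\<omega> c. \<lbrakk>\<omega> \<ge> \<Lambda>; \<bar>c\<bar> \<le> L\<rbrakk> \<Longrightarrow>
      \<bar>sqrt (\<kappa> * \<omega> / 2) * integral {a..b} (\<lambda>x. sin (c * x + \<omega> * g x))
        - (integral {-M..M} (\<lambda>u. cos (u^2)) * sin (c * x0 + \<omega> * h)
           - integral {-M..M} (\<lambda>u. sin (u^2)) * cos (c * x0 + \<omega> * h))\<bar> \<le> \<epsilon>"
proof -
  define M where "M = max 1 (64 / \<epsilon>)"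
  have M: "M \<ge> 1" "64 / \<epsilon> \<le> M" by (auto simp: M_def)
  then have M2: "32 / M \<le> \<epsilon> / 2" using \<open>\<epsilon> > 0\<close> by (simp add: field_simps)
  \<comment> \<open>The first bound keeps the chords to the peak steep, the second makes the quadratic
      remainder contribute at most \<open>\<epsilon> / 4\<close> on the rescaled window of length \<open>2 M\<close>.\<close>
  define e where "e = min (\<kappa> / 4) (\<epsilon> * \<kappa> / (16 * M^3))"
  have e: "e > 0" "e \<le> \<kappa> / 4" "e \<le> \<epsilon> * \<kappa> / (16 * M^3)" using M \<open>\<kappa> > 0\<close> \<open>\<epsilon> > 0\<close> by (auto simp: e_def)
  obtain \<eta>0 where \<eta>0: "\<eta>0 > 0" "\<And>s. \<bar>s\<bar> \<le> \<eta>0 \<Longrightarrow> \<bar>g (x0 + s) - h + \<kappa> * s^2 / 2\<bar> \<le> e * s^2"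
    using peano e(1) unfolding parabolic_peak_def by blast
  define \<eta> where "\<eta> = min \<eta>0 (min (b - x0) (x0 - a))"
  have \<eta>: "\<eta> > 0" "\<eta> \<le> b - x0" "\<eta> \<le> x0 - a" "\<eta> \<le> \<eta>0" using x0 \<eta>0 by (auto simp: \<eta>_def)
  have gx0: "g x0 = h" using \<eta>0(2)[of 0] \<eta>0(1) by simp
  \<comment> \<open>In turn: the linear term \<open>c x\<close> does not spoil the steepness of the tails; it moves the phase
      on the window by little; the window fits into the range of validity of the expansion.\<close>
  define \<mu>0 where "\<mu>0 = max (max 1 (4 * L / M)) (max (8 * L * M^2 / \<epsilon>) (M / \<eta>))"
  have \<mu>0: "\<mu>0 \<ge> 1" "\<mu>0 \<ge> 4 * L / M" "\<mu>0 \<ge> 8 * L * M^2 / \<epsilon>" "\<mu>0 \<ge> M / \<eta>"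
    by (auto simp: \<mu>0_def)
  have main: "\<bar>sqrt (\<kappa> * \<omega> / 2) * integral {a..b} (\<lambda>x. sin (c * x + \<omega> * g x))
        - (integral {-M..M} (\<lambda>u. cos (u^2)) * sin (c * x0 + \<omega> * h)
           - integral {-M..M} (\<lambda>u. sin (u^2)) * cos (c * x0 + \<omega> * h))\<bar> \<le> \<epsilon>"
    if \<omega>: "\<omega> \<ge> 2 * \<mu>0^2 / \<kappa>" and c: "\<bar>c\<bar> \<le> L" for \<omega> c
  proof -
    define \<mu> where "\<mu> = sqrt (\<kappa> * \<omega> / 2)"
    have "\<omega> \<ge> 0" using \<omega> \<open>\<kappa> > 0\<close> by (meson divide_nonneg_pos mult_nonneg_nonneg order_trans zero_le_numeral zero_le_power2)
    then have \<mu>sq: "\<mu>^2 = \<kappa> * \<omega> / 2" using \<open>\<kappa> > 0\<close> by (simp add: \<mu>_def)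
    have "\<mu>0^2 \<le> \<kappa> * \<omega> / 2" using \<omega> \<open>\<kappa> > 0\<close> by (simp add: field_simps)
    then have "\<mu> \<ge> \<mu>0" unfolding \<mu>_def by (rule real_le_rsqrt)
    then have \<mu>: "\<mu> \<ge> 1" "\<mu> \<ge> 4 * L / M" "\<mu> \<ge> 8 * L * M^2 / \<epsilon>" "\<mu> \<ge> M / \<eta>"
      using \<mu>0 by auto
    define r where "r = M / \<mu>"
    have r: "r > 0" "r \<le> \<eta>" "\<mu> * r = M" using M \<mu> \<eta> by (auto simp: r_def field_simps)
    define \<alpha> where "\<alpha> = c * x0 + \<omega> * h"
    define \<phi> where "\<phi> = (\<lambda>x. c * x + \<omega> * g x)"
    have conc\<phi>: "concave_on {a..b} \<phi>" unfolding \<phi>_def by (rule concave_phase[OF conc \<open>\<omega> \<ge> 0\<close>])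
    have int: "(\<lambda>x. sin (\<phi> x)) integrable_on {u..v}" if "a \<le> u" "v \<le> b" for u v
      using integrable_sin_concave(2)[OF conc\<phi>] that by (rule_tac integrable_subinterval_real) auto
    define m where "m = \<mu> * M / 4"
    have "m > 0" using \<mu> M by (simp add: m_def)
    have drop: "\<phi> (x0 + s) - \<phi> x0 \<le> - m * r" if "\<bar>s\<bar> = r" for s
    proof -
      have s2: "s^2 = r^2" using that by (metis power2_abs)
      have "g (x0 + s) - h \<le> e * r^2 - \<kappa> * r^2 / 2"
        using \<eta>0(2)[of s] that r \<eta> s2 by (auto simp: abs_le_iff)
      also have "\<dots> \<le> \<kappa> / 4 * r^2 - \<kappa> * r^2 / 2"
        using e by (intro diff_right_mono mult_right_mono) auto
      finally have "g (x0 + s) - h \<le> - (\<kappa> / 4 * r^2)" by simp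
      then have "\<omega> * (g (x0 + s) - h) \<le> \<omega> * - (\<kappa> / 4 * r^2)"
        using \<open>\<omega> \<ge> 0\<close> by (rule mult_left_mono)
      also have "\<dots> = - (\<mu>^2 * r^2 / 2)" by (simp add: \<mu>sq)
      also have "\<mu>^2 * r^2 = (\<mu> * M) * r" using r(3) by (simp add: power2_eq_square mult_ac)
      finally have 1: "\<omega> * (g (x0 + s) - h) \<le> - (\<mu> * M * r / 2)" .
      have "c * s \<le> L * r" using c that by (metis abs_ge_self abs_mult mult_right_mono order_trans abs_ge_zero)
      moreover have "L \<le> m" using \<mu>(2) M by (simp add: m_def field_simps)
      then have "L * r \<le> m * r" using r by simp
      ultimately have "c * s \<le> \<mu> * M * r / 4" by (simp add: m_def)
      with 1 show ?thesis by (simp add: \<phi>_def gx0 m_def algebra_simps)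
    qed
    have right: "\<bar>integral {x0 + r..b} (\<lambda>x. sin (\<phi> x))\<bar> \<le> 4 / m"
    proof (rule van_der_corput_decreasing[OF _ \<open>m > 0\<close>])
      show "concave_on {x0 + r..b} \<phi>" using conc\<phi> x0 r
        by (auto simp: concave_on_def intro: convex_on_subset)
      fix x y assume xy: "x0 + r \<le> x" "x < y" "y \<le> b"
      have "\<phi> y - \<phi> x \<le> (\<phi> (x0 + r) - \<phi> x0) / (x0 + r - x0) * (y - x)"
        using xy x0 r by (intro concave_chord_slope(1)[OF conc\<phi>]) auto
      also have "\<dots> \<le> - m * (y - x)"
        using drop[of r] r xy by (intro mult_right_mono) (auto simp: field_simps)
      finally show "\<phi> y - \<phi> x \<le> - m * (y - x)" .
    qed
    have left: "\<bar>integral {a..x0 - r} (\<lambda>x. sin (\<phi> x))\<bar> \<le> 4 / m"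
    proof (rule van_der_corput_increasing[OF _ \<open>m > 0\<close>])
      show "concave_on {a..x0 - r} \<phi>" using conc\<phi> x0 r
        by (auto simp: concave_on_def intro: convex_on_subset)
      fix x y assume xy: "a \<le> x" "x < y" "y \<le> x0 - r"
      have "(\<phi> x0 - \<phi> (x0 - r)) / (x0 - (x0 - r)) * (y - x) \<le> \<phi> y - \<phi> x"
        using xy x0 r by (intro concave_chord_slope(2)[OF conc\<phi>]) auto
      moreover have "m * (y - x) \<le> (\<phi> x0 - \<phi> (x0 - r)) / (x0 - (x0 - r)) * (y - x)"
        using drop[of "- r"] r xy by (intro mult_right_mono) (auto simp: field_simps)
      ultimately show "m * (y - x) \<le> \<phi> y - \<phi> x" by linarith
    qed
    let ?I = "{x0 - r..x0 + r}"
    let ?q = "\<lambda>x. sin (\<alpha> - \<mu>^2 * (x - x0)^2)"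
    have qint: "?q integrable_on ?I" by (intro integrable_continuous_real continuous_intros)
    define X where "X = integral {-M..M} (\<lambda>u::real. cos (u^2))"
    define Y where "Y = integral {-M..M} (\<lambda>u::real. sin (u^2))"
    have "((\<lambda>u. cos (u^2) * sin \<alpha> - sin (u^2) * cos \<alpha>) has_integral (X * sin \<alpha> - Y * cos \<alpha>)) {-M..M}"
      unfolding X_def Y_def
      by (intro has_integral_diff has_integral_mult_left integrable_integral integrable_continuous_real continuous_intros)
    then have "((\<lambda>u. sin (\<alpha> - u^2)) has_integral (X * sin \<alpha> - Y * cos \<alpha>)) (cbox (-M) M)"
      by (simp add: sin_diff mult.commute)
    from has_integral_affinity[OF this, of \<mu> "- \<mu> * x0"]
    have "((\<lambda>x. sin (\<alpha> - (\<mu> * x - \<mu> * x0)^2)) has_integral (1 / \<mu>) * (X * sin \<alpha> - Y * cos \<alpha>))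
        ((\<lambda>x. (1 / \<mu>) * x + x0) ` cbox (-M) M)"
      using \<mu> by simp
    also have "(\<lambda>x. (1 / \<mu>) * x + x0) ` cbox (-M) M = ?I"
      unfolding cbox_interval image_affinity_atLeastAtMost using M \<mu> by (simp add: r_def)
    finally have "integral ?I ?q = (1 / \<mu>) * (X * sin \<alpha> - Y * cos \<alpha>)"
      by (simp add: integral_unique power_mult_distrib flip: right_diff_distrib)
    then have main_term: "\<mu> * integral ?I ?q = X * sin \<alpha> - Y * cos \<alpha>"
      using \<mu> by simp
    define \<rho> where "\<rho> = L * r + \<omega> * e * r^2"
    have "norm (integral ?I (\<lambda>x. sin (\<phi> x) - ?q x)) \<le> integral ?I (\<lambda>x. \<rho>)"
    proof (rule integral_norm_bound_integral)
      show "(\<lambda>x. sin (\<phi> x) - ?q x) integrable_on ?I"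
        using int[of "x0 - r" "x0 + r"] qint r \<eta> by (intro integrable_diff) auto
      fix x assume "x \<in> ?I"
      define s where "s = x - x0"
      have s: "\<bar>s\<bar> \<le> r" "x = x0 + s" using \<open>x \<in> ?I\<close> by (auto simp: s_def)
      have s2: "s^2 \<le> r^2" using s(1) by (metis abs_ge_zero power2_abs power_mono)
      have "\<phi> x - (\<alpha> - \<mu>^2 * (x - x0)^2) = c * s + \<omega> * (g (x0 + s) - h + \<kappa> * s^2 / 2)"
        by (simp add: \<phi>_def \<alpha>_def \<mu>sq s(2) algebra_simps)
      also have "\<bar>\<dots>\<bar> \<le> \<bar>c\<bar> * \<bar>s\<bar> + \<omega> * \<bar>g (x0 + s) - h + \<kappa> * s^2 / 2\<bar>"
        using \<open>\<omega> \<ge> 0\<close> by (intro order_trans[OF abs_triangle_ineq]) (simp add: abs_mult)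
      also have "\<dots> \<le> L * r + \<omega> * (e * r^2)"
      proof (intro add_mono mult_mono mult_left_mono)
        have "\<bar>g (x0 + s) - h + \<kappa> * s^2 / 2\<bar> \<le> e * s^2" using \<eta>0(2)[of s] s r \<eta> by auto
        also have "\<dots> \<le> e * r^2" using s2 e by (intro mult_left_mono) auto
        finally show "\<bar>g (x0 + s) - h + \<kappa> * s^2 / 2\<bar> \<le> e * r^2" .
      qed (use c s \<open>L \<ge> 0\<close> \<open>\<omega> \<ge> 0\<close> in auto)
      finally have "\<bar>\<phi> x - (\<alpha> - \<mu>^2 * (x - x0)^2)\<bar> \<le> \<rho>" by (simp add: \<rho>_def)
      then show "norm (sin (\<phi> x) - ?q x) \<le> \<rho>"
        using abs_sin_diff_le[of "\<phi> x" "\<alpha> - \<mu>^2 * (x - x0)^2"] by simp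
    qed auto
    also have "\<dots> = 2 * r * \<rho>" using r by simp
    finally have "\<bar>integral ?I (\<lambda>x. sin (\<phi> x)) - integral ?I ?q\<bar> \<le> 2 * r * \<rho>"
      using int[of "x0 - r" "x0 + r"] qint r \<eta> by (simp add: integral_diff)
    then have "\<mu> * \<bar>integral ?I (\<lambda>x. sin (\<phi> x)) - integral ?I ?q\<bar> \<le> \<mu> * (2 * r * \<rho>)"
      using \<mu> by (intro mult_left_mono) auto
    also have "\<dots> = 2 * M * \<rho>" using r(3) by (simp add: mult_ac)
    also have "\<dots> \<le> \<epsilon> / 2"
    proof -
      have "L * r = L * M / \<mu>" by (simp add: r_def)
      moreover have "2 * M * (L * M / \<mu>) \<le> \<epsilon> / 4"
        using \<mu>(1,3) \<open>\<epsilon> > 0\<close> by (simp add: field_simps power2_eq_square)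
      moreover have "\<omega> * e * r^2 = 2 * e * M^2 / \<kappa>"
      proof -
        have "\<kappa> * (\<omega> * e * r^2) = 2 * e * (\<mu> * r)^2" by (simp add: \<mu>sq power_mult_distrib)
        then show ?thesis using r(3) \<open>\<kappa> > 0\<close> by (simp add: field_simps)
      qed
      moreover have "2 * M * (2 * e * M^2 / \<kappa>) \<le> \<epsilon> / 4"
        using e(3) M \<open>\<kappa> > 0\<close> by (simp add: field_simps power2_eq_square power3_eq_cube)
      moreover have "2 * M * \<rho> = 2 * M * (L * r) + 2 * M * (\<omega> * e * r^2)"
        unfolding \<rho>_def by (rule distrib_left)
      ultimately show ?thesis by simp
    qed
    finally have central: "\<bar>\<mu> * integral ?I (\<lambda>x. sin (\<phi> x)) - \<mu> * integral ?I ?q\<bar> \<le> \<epsilon> / 2"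
      using \<mu> by (simp add: abs_mult flip: right_diff_distrib)
    have tail: "\<bar>\<mu> * J\<bar> \<le> 16 / M" if "\<bar>J\<bar> \<le> 4 / m" for J
    proof -
      have "\<mu> * \<bar>J\<bar> \<le> \<mu> * (4 / m)" using that \<mu> by (intro mult_left_mono) auto
      also have "\<dots> = 16 / M" using \<mu> M by (simp add: m_def field_simps)
      finally show ?thesis using \<mu> by (simp add: abs_mult)
    qed
    have split: "integral {a..b} (\<lambda>x. sin (\<phi> x)) = integral {a..x0 - r} (\<lambda>x. sin (\<phi> x))
        + integral ?I (\<lambda>x. sin (\<phi> x)) + integral {x0 + r..b} (\<lambda>x. sin (\<phi> x))"
    proof -
      have "integral {a..b} (\<lambda>x. sin (\<phi> x)) = integral {a..x0 - r} (\<lambda>x. sin (\<phi> x)) + integral {x0 - r..b} (\<lambda>x. sin (\<phi> x))"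
        using r \<eta> x0 int by (intro Henstock_Kurzweil_Integration.integral_combine[symmetric]) auto
      also have "integral {x0 - r..b} (\<lambda>x. sin (\<phi> x)) = integral ?I (\<lambda>x. sin (\<phi> x)) + integral {x0 + r..b} (\<lambda>x. sin (\<phi> x))"
        using r \<eta> x0 int by (intro Henstock_Kurzweil_Integration.integral_combine[symmetric]) auto
      finally show ?thesis by simp
    qed
    have "\<mu> * integral {a..b} (\<lambda>x. sin (\<phi> x)) - (X * sin \<alpha> - Y * cos \<alpha>)
      = \<mu> * integral {a..x0 - r} (\<lambda>x. sin (\<phi> x)) + \<mu> * integral {x0 + r..b} (\<lambda>x. sin (\<phi> x))
        + (\<mu> * integral ?I (\<lambda>x. sin (\<phi> x)) - \<mu> * integral ?I ?q)"
      unfolding split main_term by (simp add: algebra_simps)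
    also have "\<bar>\<dots>\<bar> \<le> 16 / M + 16 / M + \<epsilon> / 2"
      using tail[OF left] tail[OF right] central by linarith
    also have "\<dots> \<le> \<epsilon>" using M2 by simp
    finally show ?thesis by (simp add: \<mu>_def \<phi>_def X_def Y_def \<alpha>_def)
  qed
  show ?thesis
  proof (rule that[of M "2 * \<mu>0^2 / \<kappa>"])
    show "2 * \<mu>0^2 / \<kappa> > 0" using \<mu>0(1) \<open>\<kappa> > 0\<close> by (intro divide_pos_pos mult_pos_pos zero_less_power) auto
  qed (use M main in auto)
qed

section \<open>The highest point of a curved boundary\<close>

lemma local_param_derivs:
  assumes "local_param S I \<gamma>" "t \<in> I"
  shows "((\<lambda>t. \<gamma> t $ i) has_real_derivative vderiv 1 \<gamma> t $ i) (at t)"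
    and "((\<lambda>t. vderiv 1 \<gamma> t $ i) has_real_derivative vderiv 2 \<gamma> t $ i) (at t)"
proof -
  have I: "open I" and C: "C_infinity_on I \<gamma>" using assms(1) by (auto simp: local_param_def)
  have step: "((\<lambda>t. vderiv n \<gamma> t $ i) has_real_derivative vderiv (Suc n) \<gamma> t $ i) (at t)" for n
  proof -
    have "vderiv n \<gamma> differentiable (at t)"
      using C I assms(2) by (metis C_infinity_on_def at_within_open differentiable_on_def)
    then have "(vderiv n \<gamma> has_vector_derivative vderiv (Suc n) \<gamma> t) (at t)"
      by (simp add: vector_derivative_works vderiv_def)
    from bounded_linear.has_vector_derivative[OF bounded_linear_vec_nth[of i] this]
    show ?thesis by (simp add: has_real_derivative_iff_has_vector_derivative)
  qed
  show "((\<lambda>t. \<gamma> t $ i) has_real_derivative vderiv 1 \<gamma> t $ i) (at t)"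
    using step[of 0] by (simp add: vderiv_def)
  show "((\<lambda>t. vderiv 1 \<gamma> t $ i) has_real_derivative vderiv 2 \<gamma> t $ i) (at t)"
    using step[of 1] by (simp add: numeral_2_eq_2)
qed

text \<open>
  This excludes bodies with empty interior: they lie in a line and coincide with their boundary.
\<close>
lemma curvature_zero_in_line:
  assumes lp: "local_param S I \<gamma>" "t \<in> I" and line: "\<gamma> ` I \<subseteq> {x. a \<bullet> x = b}" "a \<noteq> 0"
  shows "curvature \<gamma> t = 0"
proof -
  have I: "open I" using lp by (auto simp: local_param_def)
  have 1: "a $ 1 * vderiv 1 \<gamma> t $ 1 + a $ 2 * vderiv 1 \<gamma> t $ 2 = 0" if "t \<in> I" for t
  proof (rule DERIV_unique)
    show "((\<lambda>t. a $ 1 * \<gamma> t $ 1 + a $ 2 * \<gamma> t $ 2) has_real_derivative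
        (a $ 1 * vderiv 1 \<gamma> t $ 1 + a $ 2 * vderiv 1 \<gamma> t $ 2)) (at t)"
      by (intro DERIV_add DERIV_cmult local_param_derivs(1)[OF lp(1) that])
    show "((\<lambda>t. a $ 1 * \<gamma> t $ 1 + a $ 2 * \<gamma> t $ 2) has_real_derivative 0) (at t)"
      by (rule has_field_derivative_transform_within_open[of "\<lambda>_. b" _ _ I])
        (use line that I in \<open>auto simp: inner_real2\<close>)
  qed
  have 2: "a $ 1 * vderiv 2 \<gamma> t $ 1 + a $ 2 * vderiv 2 \<gamma> t $ 2 = 0"
  proof (rule DERIV_unique)
    show "((\<lambda>t. a $ 1 * vderiv 1 \<gamma> t $ 1 + a $ 2 * vderiv 1 \<gamma> t $ 2) has_real_derivative
        (a $ 1 * vderiv 2 \<gamma> t $ 1 + a $ 2 * vderiv 2 \<gamma> t $ 2)) (at t)"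
      by (intro DERIV_add DERIV_cmult local_param_derivs(2)[OF lp])
    show "((\<lambda>t. a $ 1 * vderiv 1 \<gamma> t $ 1 + a $ 2 * vderiv 1 \<gamma> t $ 2) has_real_derivative 0) (at t)"
      by (rule has_field_derivative_transform_within_open[of "\<lambda>_. 0" _ _ I])
        (use 1 lp(2) I in \<open>auto\<close>)
  qed
  let ?d = "vderiv 1 \<gamma> t $ 1 * vderiv 2 \<gamma> t $ 2 - vderiv 1 \<gamma> t $ 2 * vderiv 2 \<gamma> t $ 1"
  have "a $ 1 * ?d = (a $ 1 * vderiv 1 \<gamma> t $ 1 + a $ 2 * vderiv 1 \<gamma> t $ 2) * vderiv 2 \<gamma> t $ 2
      - (a $ 1 * vderiv 2 \<gamma> t $ 1 + a $ 2 * vderiv 2 \<gamma> t $ 2) * vderiv 1 \<gamma> t $ 2"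
    by (simp add: algebra_simps)
  then have e1: "a $ 1 * ?d = 0" unfolding 1[OF lp(2)] 2 by simp
  have "a $ 2 * ?d = (a $ 1 * vderiv 2 \<gamma> t $ 1 + a $ 2 * vderiv 2 \<gamma> t $ 2) * vderiv 1 \<gamma> t $ 1
      - (a $ 1 * vderiv 1 \<gamma> t $ 1 + a $ 2 * vderiv 1 \<gamma> t $ 2) * vderiv 2 \<gamma> t $ 1"
    by (simp add: algebra_simps)
  then have e2: "a $ 2 * ?d = 0" unfolding 1[OF lp(2)] 2 by simp
  have "?d = 0" using e1 e2 \<open>a \<noteq> 0\<close> by (auto simp: vec_eq_iff forall_2)
  then show ?thesis by (simp add: curvature_def)
qed

lemma peano_first_order:
  assumes "(f has_real_derivative d) (at t0)" "e > 0"
  shows "\<exists>\<delta>>0. \<forall>\<tau>. \<bar>\<tau>\<bar> \<le> \<delta> \<longrightarrow> \<bar>f (t0 + \<tau>) - f t0 - d * \<tau>\<bar> \<le> e * \<bar>\<tau>\<bar>"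
proof -
  obtain \<delta> where \<delta>: "\<delta> > 0" "\<And>y. norm (y - t0) < \<delta> \<Longrightarrow> norm (f y - f t0 - d * (y - t0)) \<le> e * norm (y - t0)"
    using assms unfolding has_field_derivative_def has_derivative_at_alt by blast
  have "\<bar>f (t0 + \<tau>) - f t0 - d * \<tau>\<bar> \<le> e * \<bar>\<tau>\<bar>" if "\<bar>\<tau>\<bar> \<le> \<delta> / 2" for \<tau>
    using \<delta>(2)[of "t0 + \<tau>"] that \<delta>(1) by auto
  then show ?thesis using \<delta>(1) by (intro exI[of _ "\<delta> / 2"]) auto
qed

lemma peano_second_order:
  fixes f f' :: "real \<Rightarrow> real"
  assumes I: "open I" "t0 \<in> I" and d1: "\<And>t. t \<in> I \<Longrightarrow> (f has_real_derivative f' t) (at t)"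
    and crit: "f' t0 = 0" and d2: "(f' has_real_derivative f2) (at t0)" and "e > 0"
  shows "\<exists>\<delta>>0. \<forall>\<tau>. \<bar>\<tau>\<bar> \<le> \<delta> \<longrightarrow> \<bar>f (t0 + \<tau>) - f t0 - f2 * \<tau>^2 / 2\<bar> \<le> e * \<tau>^2"
proof -
  obtain \<delta>1 where \<delta>1: "\<delta>1 > 0" "\<And>\<tau>. \<bar>\<tau>\<bar> \<le> \<delta>1 \<Longrightarrow> \<bar>f' (t0 + \<tau>) - f2 * \<tau>\<bar> \<le> e * \<bar>\<tau>\<bar>"
    using peano_first_order[OF d2 \<open>e > 0\<close>] crit by auto
  obtain \<delta>2 where \<delta>2: "\<delta>2 > 0" "cball t0 \<delta>2 \<subseteq> I"
    using I open_contains_cball by blast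
  have "\<bar>f (t0 + \<tau>) - f t0 - f2 * \<tau>^2 / 2\<bar> \<le> e * \<tau>^2" if "\<bar>\<tau>\<bar> \<le> min \<delta>1 \<delta>2" for \<tau>
  proof -
    let ?F = "\<lambda>\<sigma>. f (t0 + \<sigma>) - f2 * \<sigma>^2 / 2"
    let ?S = "{- \<bar>\<tau>\<bar>..\<bar>\<tau>\<bar>}"
    have "norm (?F \<tau> - ?F 0) \<le> (e * \<bar>\<tau>\<bar>) * norm (\<tau> - 0)"
    proof (rule field_differentiable_bound[of ?S ?F "\<lambda>\<sigma>. f' (t0 + \<sigma>) - f2 * \<sigma>"])
      fix \<sigma> assume \<sigma>: "\<sigma> \<in> ?S"
      then have "\<bar>\<sigma>\<bar> \<le> \<bar>\<tau>\<bar>" by auto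
      then have "t0 + \<sigma> \<in> I" using \<delta>2 that by (auto simp: dist_real_def subset_iff)
      then have "(f has_real_derivative f' (t0 + \<sigma>)) (at (t0 + \<sigma>))" by (rule d1)
      then have "((\<lambda>\<sigma>. f (t0 + \<sigma>)) has_real_derivative f' (t0 + \<sigma>)) (at \<sigma>)"
        using DERIV_shift[of f "f' (t0 + \<sigma>)" \<sigma> t0] by (simp add: add.commute)
      moreover have quad: "((\<lambda>\<sigma>. f2 * \<sigma>^2 / 2) has_real_derivative f2 * \<sigma>) (at \<sigma>)"
        by (auto intro!: derivative_eq_intros)
      ultimately show "(?F has_real_derivative f' (t0 + \<sigma>) - f2 * \<sigma>) (at \<sigma> within ?S)"
        using DERIV_diff[OF _ quad] by (blast intro: has_field_derivative_at_within)
      have "\<bar>f' (t0 + \<sigma>) - f2 * \<sigma>\<bar> \<le> e * \<bar>\<sigma>\<bar>" using \<delta>1(2)[of \<sigma>] that \<open>\<bar>\<sigma>\<bar> \<le> \<bar>\<tau>\<bar>\<close> by auto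
      also have "\<dots> \<le> e * \<bar>\<tau>\<bar>" using \<open>\<bar>\<sigma>\<bar> \<le> \<bar>\<tau>\<bar>\<close> \<open>e > 0\<close> by simp
      finally show "norm (f' (t0 + \<sigma>) - f2 * \<sigma>) \<le> e * \<bar>\<tau>\<bar>" by simp
    qed auto
    then show ?thesis by (simp add: power2_eq_square mult.assoc algebra_simps)
  qed
  then show ?thesis using \<delta>1(1) \<delta>2(1) by (intro exI[of _ "min \<delta>1 \<delta>2"]) auto
qed

text \<open>
  Let \<open>(u, v)\<close> be a curve with \<open>u = x0 + d \<tau> + o(\<tau>)\<close> and \<open>v = h + f2 \<tau>\<^sup>2 / 2 + o(\<tau>\<^sup>2)\<close> at the
  parameter \<open>t0 + \<tau>\<close>. For small \<open>s\<close> the intermediate value theorem gives \<open>\<tau>\<close> of size at most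
  \<open>2 \<bar>s\<bar> / \<bar>d\<bar>\<close> with \<open>u = x0 + s\<close>; inserting \<open>\<tau> = s / d + o(s)\<close> gives the expansion of the curve as
  a graph over its first coordinate.
\<close>
lemma graph_of_curve_peano:
  fixes u v :: "real \<Rightarrow> real"
  assumes u: "\<And>e. e > 0 \<Longrightarrow> \<exists>\<delta>>0. \<forall>\<tau>. \<bar>\<tau>\<bar> \<le> \<delta> \<longrightarrow> \<bar>u (t0 + \<tau>) - x0 - d * \<tau>\<bar> \<le> e * \<bar>\<tau>\<bar>"
    and v: "\<And>e. e > 0 \<Longrightarrow> \<exists>\<delta>>0. \<forall>\<tau>. \<bar>\<tau>\<bar> \<le> \<delta> \<longrightarrow> \<bar>v (t0 + \<tau>) - h - f2 * \<tau>^2 / 2\<bar> \<le> e * \<tau>^2"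
    and "d \<noteq> 0" "\<delta>0 > 0" and cont: "continuous_on {t0 - \<delta>0..t0 + \<delta>0} u" and "e > 0"
  shows "\<exists>\<eta>>0. \<forall>s. \<bar>s\<bar> \<le> \<eta> \<longrightarrow> (\<exists>\<tau>. \<bar>\<tau>\<bar> \<le> \<delta>0 \<and> u (t0 + \<tau>) = x0 + s
            \<and> \<bar>v (t0 + \<tau>) - h + (- f2 / d^2) * s^2 / 2\<bar> \<le> e * s^2)"
proof -
  define D where "D = \<bar>d\<bar>"
  have D: "D > 0" "d^2 = D^2" using \<open>d \<noteq> 0\<close> by (auto simp: D_def)
  \<comment> \<open>\<open>e1\<close> and \<open>e2\<close> are chosen so that the errors in \<open>u\<close> and \<open>v\<close> each account for at most \<open>e s\<^sup>2 / 2\<close> in the end.\<close>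
  define e1 where "e1 = min (D / 2) (e * D^3 / (12 * (\<bar>f2\<bar> + 1)))"
  have "e1 > 0" using D \<open>e > 0\<close> by (simp add: e1_def add_nonneg_pos)
  moreover have "e1 \<le> D / 2" unfolding e1_def by (rule min.cobounded1)
  moreover have "e1 \<le> e * D^3 / (12 * (\<bar>f2\<bar> + 1))" unfolding e1_def by (rule min.cobounded2)
  ultimately have e1: "e1 > 0" "e1 \<le> D / 2" "e1 \<le> e * D^3 / (12 * (\<bar>f2\<bar> + 1))" by auto
  define e2 where "e2 = e * D^2 / 8"
  have "e2 > 0" using D \<open>e > 0\<close> by (simp add: e2_def)
  obtain \<delta>1 where \<delta>1: "\<delta>1 > 0" "\<And>\<tau>. \<bar>\<tau>\<bar> \<le> \<delta>1 \<Longrightarrow> \<bar>u (t0 + \<tau>) - x0 - d * \<tau>\<bar> \<le> e1 * \<bar>\<tau>\<bar>"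
    using u[OF e1(1)] by blast
  obtain \<delta>2 where \<delta>2: "\<delta>2 > 0" "\<And>\<tau>. \<bar>\<tau>\<bar> \<le> \<delta>2 \<Longrightarrow> \<bar>v (t0 + \<tau>) - h - f2 * \<tau>^2 / 2\<bar> \<le> e2 * \<tau>^2"
    using v[OF \<open>e2 > 0\<close>] by blast
  define \<delta> where "\<delta> = min \<delta>0 (min \<delta>1 \<delta>2)"
  have \<delta>: "\<delta> > 0" "\<delta> \<le> \<delta>0" "\<delta> \<le> \<delta>1" "\<delta> \<le> \<delta>2" using \<delta>1 \<delta>2 \<open>\<delta>0 > 0\<close> by (auto simp: \<delta>_def)
  have u0: "u t0 = x0" using \<delta>1(2)[of 0] \<delta>1(1) by simp
  have "\<exists>\<tau>. \<bar>\<tau>\<bar> \<le> \<delta>0 \<and> u (t0 + \<tau>) = x0 + s \<and> \<bar>v (t0 + \<tau>) - h + (- f2 / d^2) * s^2 / 2\<bar> \<le> e * s^2"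
    if s: "\<bar>s\<bar> \<le> D * \<delta> / 2" for s
  proof -
    \<comment> \<open>At this parameter \<open>u - x0\<close> is \<open>2 s\<close> up to an error \<open>\<bar>s\<bar>\<close>, so the value \<open>x0 + s\<close> is attained on the way.\<close>
    define \<tau>1 where "\<tau>1 = 2 * s / d"
    have \<tau>1: "\<bar>\<tau>1\<bar> \<le> \<delta>" "d * \<tau>1 = 2 * s" "\<bar>\<tau>1\<bar> = 2 * \<bar>s\<bar> / D"
      using s D \<open>d \<noteq> 0\<close> by (auto simp: \<tau>1_def abs_mult D_def field_simps)
    define \<psi> where "\<psi> = (\<lambda>w. sgn s * (u (t0 + w * \<tau>1) - x0))"
    have "\<bar>u (t0 + \<tau>1) - x0 - 2 * s\<bar> \<le> e1 * \<bar>\<tau>1\<bar>" using \<delta>1(2)[of \<tau>1] \<tau>1 \<delta> by auto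
    also have "\<dots> \<le> D / 2 * \<bar>\<tau>1\<bar>" using e1 by (intro mult_right_mono) auto
    also have "\<dots> = \<bar>s\<bar>" using \<tau>1(3) D by simp
    finally have far: "\<bar>u (t0 + \<tau>1) - x0 - 2 * s\<bar> \<le> \<bar>s\<bar>" .
    have "\<exists>w\<ge>0. w \<le> 1 \<and> \<psi> w = \<bar>s\<bar>"
    proof (rule IVT')
      show "\<psi> 0 \<le> \<bar>s\<bar>" by (simp add: \<psi>_def u0)
      show "\<bar>s\<bar> \<le> \<psi> 1" using far by (auto simp: \<psi>_def sgn_if abs_if split: if_splits)
      have "continuous_on {0..1} (\<lambda>w. u (t0 + w * \<tau>1))"
      proof (rule continuous_on_compose2[OF cont])
        show "(\<lambda>w. t0 + w * \<tau>1) ` {0..1} \<subseteq> {t0 - \<delta>0..t0 + \<delta>0}"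
        proof
          fix z assume "z \<in> (\<lambda>w. t0 + w * \<tau>1) ` {0..1}"
          then obtain w where w: "0 \<le> w" "w \<le> 1" "z = t0 + w * \<tau>1" by auto
          then have "\<bar>w * \<tau>1\<bar> \<le> \<delta>0" using \<tau>1(1) \<delta>(2) mult_mono[of "\<bar>w\<bar>" 1 "\<bar>\<tau>1\<bar>" \<delta>0] by (auto simp: abs_mult)
          then show "z \<in> {t0 - \<delta>0..t0 + \<delta>0}" using w by auto
        qed
      qed (auto intro!: continuous_intros)
      then show "continuous_on {0..1} \<psi>" unfolding \<psi>_def by (intro continuous_intros)
    qed auto
    then obtain w where w: "0 \<le> w" "w \<le> 1" "\<psi> w = \<bar>s\<bar>" by blast
    define \<tau> where "\<tau> = w * \<tau>1"
    have \<tau>: "\<bar>\<tau>\<bar> \<le> \<bar>\<tau>1\<bar>" using w mult_right_mono[of w 1 "\<bar>\<tau>1\<bar>"] by (simp add: \<tau>_def abs_mult)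
    have ux: "u (t0 + \<tau>) = x0 + s"
    proof (cases "s = 0")
      case True then show ?thesis by (simp add: \<tau>_def \<tau>1_def u0)
    next
      case False then show ?thesis using w(3) by (auto simp: \<psi>_def \<tau>_def sgn_if abs_if split: if_splits)
    qed
    define \<rho> where "\<rho> = s - d * \<tau>"
    have \<rho>: "\<bar>\<rho>\<bar> \<le> e1 * \<bar>\<tau>\<bar>" using \<delta>1(2)[of \<tau>] \<tau> \<tau>1 \<delta> ux by (simp add: \<rho>_def)
    define \<rho>2 where "\<rho>2 = v (t0 + \<tau>) - h - f2 * \<tau>^2 / 2"
    have \<rho>2: "\<bar>\<rho>2\<bar> \<le> e2 * \<tau>^2" using \<delta>2(2)[of \<tau>] \<tau> \<tau>1 \<delta> by (simp add: \<rho>2_def)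
    have \<tau>sq: "\<tau>^2 \<le> 4 * s^2 / D^2"
    proof -
      have "\<bar>\<tau>\<bar>^2 \<le> (2 * \<bar>s\<bar> / D)^2" using \<tau> \<tau>1(3) by (intro power_mono) auto
      then show ?thesis by (simp add: power_divide power_mult_distrib)
    qed
    have "v (t0 + \<tau>) - h + (- f2 / d^2) * s^2 / 2 = \<rho>2 - f2 / (2 * D^2) * (2 * (d * \<tau>) * \<rho> + \<rho>^2)"
    proof -
      have "s^2 = D^2 * \<tau>^2 + 2 * (d * \<tau>) * \<rho> + \<rho>^2"
        unfolding D(2)[symmetric] by (simp add: \<rho>_def power2_eq_square algebra_simps)
      then show ?thesis using D(1) unfolding D(2) by (simp add: \<rho>2_def field_simps)
    qed
    also have "\<bar>\<dots>\<bar> \<le> \<bar>\<rho>2\<bar> + \<bar>f2\<bar> / (2 * D^2) * \<bar>2 * (d * \<tau>) * \<rho> + \<rho>^2\<bar>"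
      by (rule order_trans[OF abs_triangle_ineq4]) (simp add: abs_mult)
    also have "\<dots> \<le> \<bar>\<rho>2\<bar> + \<bar>f2\<bar> / (2 * D^2) * (3 * D * e1 * \<tau>^2)"
    proof (intro add_left_mono mult_left_mono)
      have a: "\<bar>2 * (d * \<tau>) * \<rho>\<bar> \<le> 2 * (D * \<bar>\<tau>\<bar>) * (e1 * \<bar>\<tau>\<bar>)"
        using \<rho> D by (simp add: abs_mult D_def mult_left_mono)
      have "\<bar>\<rho>\<bar> * \<bar>\<rho>\<bar> \<le> (e1 * \<bar>\<tau>\<bar>) * (D * \<bar>\<tau>\<bar>)"
        using \<rho> e1 D by (intro mult_mono order_trans[OF \<rho> mult_right_mono]) auto
      then have b: "\<bar>\<rho>^2\<bar> \<le> (e1 * \<bar>\<tau>\<bar>) * (D * \<bar>\<tau>\<bar>)" by (simp add: power2_eq_square)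
      have "2 * (D * \<bar>\<tau>\<bar>) * (e1 * \<bar>\<tau>\<bar>) + (e1 * \<bar>\<tau>\<bar>) * (D * \<bar>\<tau>\<bar>) = 3 * D * e1 * (\<bar>\<tau>\<bar> * \<bar>\<tau>\<bar>)"
        by (simp add: algebra_simps)
      moreover have "\<bar>\<tau>\<bar> * \<bar>\<tau>\<bar> = \<tau>^2" by (simp add: power2_eq_square)
      ultimately have "2 * (D * \<bar>\<tau>\<bar>) * (e1 * \<bar>\<tau>\<bar>) + (e1 * \<bar>\<tau>\<bar>) * (D * \<bar>\<tau>\<bar>) = 3 * D * e1 * \<tau>^2"
        by (simp only:)
      then show "\<bar>2 * (d * \<tau>) * \<rho> + \<rho>^2\<bar> \<le> 3 * D * e1 * \<tau>^2"
        using a b abs_triangle_ineq[of "2 * (d * \<tau>) * \<rho>" "\<rho>^2"] by linarith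
    qed auto
    also have "\<dots> \<le> (e2 + 3 * \<bar>f2\<bar> * e1 / (2 * D)) * \<tau>^2"
      using \<rho>2 D(1) by (simp add: power2_eq_square field_simps)
    also have "\<dots> \<le> (e2 + 3 * \<bar>f2\<bar> * e1 / (2 * D)) * (4 * s^2 / D^2)"
      using \<tau>sq e1 D \<open>e2 > 0\<close> by (intro mult_left_mono add_nonneg_nonneg) auto
    also have "\<dots> = (4 * e2 / D^2 + 6 * \<bar>f2\<bar> * e1 / D^3) * s^2"
      using D(1) by (simp add: field_simps power2_eq_square power3_eq_cube)
    also have "\<dots> \<le> e * s^2"
    proof (rule mult_right_mono)
      have "4 * e2 / D^2 = e / 2" using D by (simp add: e2_def)
      moreover have "6 * \<bar>f2\<bar> * e1 / D^3 \<le> e / 2"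
      proof -
        have "\<bar>f2\<bar> * e1 \<le> (\<bar>f2\<bar> + 1) * (e * D^3 / (12 * (\<bar>f2\<bar> + 1)))"
          using e1 by (intro mult_mono) auto
        also have "\<dots> = e * D^3 / 12"
        proof -
          have cancel: "F * (X / (12 * F)) = X / 12" if "F > 0" for F X :: real using that by simp
          show ?thesis by (rule cancel) (simp add: add_nonneg_pos)
        qed
        finally show ?thesis using D by (simp add: field_simps)
      qed
      ultimately show "4 * e2 / D^2 + 6 * \<bar>f2\<bar> * e1 / D^3 \<le> e" by simp
    qed auto
    finally show ?thesis using \<tau> \<tau>1 \<delta> ux by (intro exI[of _ \<tau>]) (auto simp del: abs_mult)
  qed
  then show ?thesis using D \<delta> by (intro exI[of _ "D * \<delta> / 2"]) auto
qed

lemma norm_pt_0 [simp]: "norm (pt 0 y) = \<bar>y\<bar>"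
  by (simp add: pt_def)

context symmetric_convex_plane
begin

lemma nonempty_interior:
  assumes "smooth_plane_curve (frontier K)" "nonvanishing_curvature (frontier K)"
  shows "interior K \<noteq> {}"
proof
  assume "interior K = {}"
  then obtain a b where ab: "a \<noteq> 0" "K \<subseteq> {x. a \<bullet> x = b}"
    using empty_interior_subset_hyperplane[OF cvx] by blast
  have "frontier K = K" using \<open>interior K = {}\<close> cpt by (simp add: frontier_def compact_imp_closed)
  then obtain p where "p \<in> frontier K" using ne by blast
  then obtain I \<gamma> where lp: "local_param (frontier K) I \<gamma>" and "p \<in> \<gamma> ` I"
    using assms(1) by (auto simp: smooth_plane_curve_def)
  then obtain t where "t \<in> I" by blast
  have "\<gamma> ` I \<subseteq> frontier K"
    using lp openin_imp_subset[of euclidean "frontier K" "\<gamma> ` I"] unfolding local_param_def by blast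
  then have "\<gamma> ` I \<subseteq> {x. a \<bullet> x = b}" using \<open>frontier K = K\<close> ab(2) by blast
  then have "curvature \<gamma> t = 0" using curvature_zero_in_line[OF lp \<open>t \<in> I\<close>] ab(1) by blast
  then show False using assms(2) lp \<open>t \<in> I\<close> by (auto simp: nonvanishing_curvature_def)
qed

text \<open>
  The origin is the midpoint of an interior point and of its reflection.
\<close>
lemma zero_interior:
  assumes "interior K \<noteq> {}"
  shows "0 \<in> interior K"
proof -
  obtain c where c: "c \<in> interior K" using assms by blast
  then have "- c \<in> K" using sym interior_subset by blast
  from mem_interior_convex_shrink[OF cvx c this, of "1/2"]
  have "- c - (1/2) *\<^sub>R (- c - c) \<in> interior K" by simp
  moreover have "- c - (1/2) *\<^sub>R (- c - c) = 0" by (simp add: vec_eq_iff)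
  ultimately show ?thesis by simp
qed

text \<open>
  The frontier consists of an upper and a lower graph, and near the highest point only the upper one is
  met. Indeed, shrinking a point of \<open>K\<close> over \<open>x / \<theta>\<close> by a factor \<open>\<theta> < 1\<close> gives an interior point over
  \<open>x\<close> of height at most \<open>\<theta> h\<close>. A point of \<open>K\<close> over \<open>x\<close> above this one and strictly below
  \<open>crest x\<close> is therefore interior.
\<close>
lemma frontier_near_top:
  assumes int: "0 \<in> interior K" and h: "h > 0" "\<And>v. v \<in> K \<Longrightarrow> v $ 2 \<le> h"
    and x0: "- halfwidth < x0" "x0 < halfwidth"
  shows "\<exists>\<eta>>0. \<forall>x y. \<bar>x - x0\<bar> \<le> \<eta> \<longrightarrow> \<bar>y - h\<bar> \<le> \<eta> \<longrightarrow> pt x y \<in> frontier K \<longrightarrow> y = crest x"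
proof -
  let ?H = halfwidth
  define \<theta> where "\<theta> = (?H + \<bar>x0\<bar>) / (2 * ?H)"
  have H: "?H > 0" "\<bar>x0\<bar> < ?H" using x0 by auto
  have \<theta>: "0 < \<theta>" "\<theta> < 1" "\<theta> * ?H = (?H + \<bar>x0\<bar>) / 2" using H by (auto simp: \<theta>_def field_simps)
  define \<eta> where "\<eta> = min ((?H - \<bar>x0\<bar>) / 2) ((1 - \<theta>) * h / 2)"
  have "\<eta> > 0" using H \<theta> h by (simp add: \<eta>_def)
  moreover have "\<eta> \<le> (?H - \<bar>x0\<bar>) / 2" unfolding \<eta>_def by (rule min.cobounded1)
  moreover have "\<eta> \<le> (1 - \<theta>) * h / 2" unfolding \<eta>_def by (rule min.cobounded2)
  ultimately have \<eta>: "\<eta> > 0" "\<eta> \<le> (?H - \<bar>x0\<bar>) / 2" "\<eta> \<le> (1 - \<theta>) * h / 2" by auto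
  have "y = crest x" if x: "\<bar>x - x0\<bar> \<le> \<eta>" and y: "\<bar>y - h\<bar> \<le> \<eta>" and fr: "pt x y \<in> frontier K" for x y
  proof (rule ccontr)
    assume "y \<noteq> crest x"
    have yK: "pt x y \<in> K" using fr cpt by (auto simp: frontier_def compact_imp_closed)
    then have "y \<le> crest x" by (intro slice_le_crest) (simp add: slice_def)
    with \<open>y \<noteq> crest x\<close> have less: "y < crest x" by simp
    have "\<bar>x\<bar> \<le> \<bar>x0\<bar> + \<bar>x - x0\<bar>" by linarith
    also have "\<dots> \<le> \<bar>x0\<bar> + (?H - \<bar>x0\<bar>) / 2" using x \<eta>(2) by simp
    also have "\<dots> = \<theta> * ?H" unfolding \<theta>(3) by (simp add: field_simps)
    finally have "\<bar>x\<bar> \<le> \<theta> * ?H" .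
    then have "x \<le> ?H * \<theta>" "- x \<le> ?H * \<theta>" by (auto simp: mult.commute)
    then have "x / \<theta> \<in> shadow" using \<theta>(1) by (simp add: shadow_eq field_simps)
    from crest_mem[OF this] have z: "pt (x / \<theta>) (crest (x / \<theta>)) \<in> K" by (simp add: slice_def)
    define y' where "y' = \<theta> * crest (x / \<theta>)"
    have "pt (x / \<theta>) (crest (x / \<theta>)) - (1 - \<theta>) *\<^sub>R (pt (x / \<theta>) (crest (x / \<theta>)) - 0) \<in> interior K"
      using mem_interior_convex_shrink[OF cvx int z] \<theta> by auto
    also have "pt (x / \<theta>) (crest (x / \<theta>)) - (1 - \<theta>) *\<^sub>R (pt (x / \<theta>) (crest (x / \<theta>)) - 0) = pt x y'"
      using \<theta> by (simp add: vec_eq_iff forall_2 y'_def algebra_simps)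
    finally have I: "pt x y' \<in> interior K" .
    have "crest (x / \<theta>) \<le> h" using h(2)[OF z] by simp
    then have "y' \<le> \<theta> * h" unfolding y'_def using \<theta> by (intro mult_left_mono) auto
    moreover have "\<theta> * h + (1 - \<theta>) * h = h" by (simp add: algebra_simps)
    moreover have "(1 - \<theta>) * h > 0" using \<theta> h by simp
    ultimately have "y' < y" using y \<eta>(3) by linarith
    have "x \<in> shadow" using yK by (auto simp: mem_shadow slice_def)
    then have top: "pt x (crest x) \<in> K" using crest_mem by (simp add: slice_def)
    define e where "e = (crest x - y) / (crest x - y')"
    have e: "0 < e" "e \<le> 1" "e * (crest x - y') = crest x - y" using less \<open>y' < y\<close> by (auto simp: e_def)
    have "pt x (crest x) - e *\<^sub>R (pt x (crest x) - pt x y') \<in> interior K"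
      using mem_interior_convex_shrink[OF cvx I top e(1,2)] .
    also have "pt x (crest x) - e *\<^sub>R (pt x (crest x) - pt x y') = pt x y"
      using e(3) by (simp add: vec_eq_iff forall_2)
    finally show False using fr by (simp add: frontier_def)
  qed
  then show ?thesis using \<eta>(1) by blast
qed

text \<open>
  At the highest point the second coordinate of a local parametrization is critical, so the first one has
  nonzero derivative, and nonvanishing curvature says that the second derivative of the second
  coordinate is nonzero; as the point is a maximum it is negative. Rewriting the curve as a graph gives
  the parabolic shape of \<open>crest\<close>.
\<close>
lemma curved_top:
  assumes smooth: "smooth_plane_curve (frontier K)" and curved: "nonvanishing_curvature (frontier K)"
  obtains x0 h \<kappa> where "- halfwidth < x0" "x0 < halfwidth" "\<kappa> > 0"
    "parabolic_peak crest x0 h \<kappa>"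
proof -
  have int: "0 \<in> interior K" using zero_interior nonempty_interior[OF assms] by blast
  obtain p where p: "p \<in> K" "\<And>v. v \<in> K \<Longrightarrow> v $ 2 \<le> p $ 2"
    using continuous_attains_sup[OF cpt ne, of "\<lambda>v. v $ 2"] continuous_on_component[of K "\<lambda>v. v" 2, OF continuous_on_id] by blast
  define x0 where "x0 = p $ 1"
  define h where "h = p $ 2"
  have above: "\<exists>v\<in>K. v $ 2 > c $ 2" if "c \<in> interior K" for c
  proof -
    obtain r where r: "r > 0" "cball c r \<subseteq> K" using \<open>c \<in> interior K\<close> mem_interior_cball by blast
    have "c + pt 0 r \<in> cball c r" using r(1) by (simp add: dist_norm)
    then show ?thesis using r by (intro bexI[of _ "c + pt 0 r"]) auto
  qed
  have h: "h > 0" using above[OF int] p(2) unfolding h_def by fastforce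
  have "p \<notin> interior K" using above[of p] p(2) by fastforce
  then have "p \<in> frontier K" using p(1) cpt by (simp add: frontier_def compact_imp_closed)
  then obtain I \<gamma> t0 where lp: "local_param (frontier K) I \<gamma>" and t0: "t0 \<in> I" "p = \<gamma> t0"
    using smooth by (auto simp: smooth_plane_curve_def)
  have I: "open I" using lp by (simp add: local_param_def)
  have fr: "\<gamma> t \<in> frontier K" if "t \<in> I" for t
    using lp that openin_imp_subset[of euclidean "frontier K" "\<gamma> ` I"] unfolding local_param_def by blast
  then have inK: "\<gamma> t \<in> K" if "t \<in> I" for t using that cpt by (auto simp: frontier_def compact_imp_closed)
  note d1 = local_param_derivs(1)[OF lp] and d2 = local_param_derivs(2)[OF lp]
  define d where "d = vderiv 1 \<gamma> t0 $ 1"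
  define f2 where "f2 = vderiv 2 \<gamma> t0 $ 2"
  obtain \<delta>0 where \<delta>0: "\<delta>0 > 0" "cball t0 \<delta>0 \<subseteq> I" using I t0 open_contains_cball by blast
  have mem: "t0 + \<tau> \<in> I" if "\<bar>\<tau>\<bar> \<le> \<delta>0" for \<tau> using \<delta>0 that by (auto simp: dist_real_def subset_iff)
  have crit: "vderiv 1 \<gamma> t0 $ 2 = 0"
  proof (rule DERIV_local_max[OF d1[OF t0(1)] \<delta>0(1)])
    show "\<forall>y. \<bar>t0 - y\<bar> < \<delta>0 \<longrightarrow> \<gamma> y $ 2 \<le> \<gamma> t0 $ 2"
      using p(2) inK t0(2) mem[of "_ - t0"] by (metis abs_minus_commute add.commute diff_add_cancel less_imp_le)
  qed
  have "vderiv 1 \<gamma> t0 \<noteq> 0" using lp t0(1) by (auto simp: local_param_def)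
  then have d: "d \<noteq> 0" using crit by (auto simp: d_def vec_eq_iff forall_2)
  have "curvature \<gamma> t0 \<noteq> 0" using curved lp t0(1) by (auto simp: nonvanishing_curvature_def)
  then have f2_0: "f2 \<noteq> 0" using crit by (auto simp: curvature_def f2_def)
  have P1: "\<exists>\<delta>>0. \<forall>\<tau>. \<bar>\<tau>\<bar> \<le> \<delta> \<longrightarrow> \<bar>\<gamma> (t0 + \<tau>) $ 1 - x0 - d * \<tau>\<bar> \<le> e * \<bar>\<tau>\<bar>" if "e > 0" for e
    using peano_first_order[OF d1[OF t0(1), of 1] that] by (simp add: x0_def d_def t0(2))
  have P2: "\<exists>\<delta>>0. \<forall>\<tau>. \<bar>\<tau>\<bar> \<le> \<delta> \<longrightarrow> \<bar>\<gamma> (t0 + \<tau>) $ 2 - h - f2 * \<tau>^2 / 2\<bar> \<le> e * \<tau>^2" if "e > 0" for e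
    using peano_second_order[OF I t0(1) d1 crit d2[OF t0(1)] that] by (simp add: h_def f2_def t0(2))
  have "f2 < 0"
  proof (rule ccontr)
    assume "\<not> f2 < 0"
    then have "f2 / 4 > 0" using f2_0 by simp
    then obtain \<delta> where \<delta>: "\<delta> > 0" "\<And>\<tau>. \<bar>\<tau>\<bar> \<le> \<delta> \<Longrightarrow> \<bar>\<gamma> (t0 + \<tau>) $ 2 - h - f2 * \<tau>^2 / 2\<bar> \<le> f2 / 4 * \<tau>^2"
      using P2 by blast
    define \<tau> where "\<tau> = min \<delta> \<delta>0"
    have \<tau>: "\<tau> > 0" "\<tau> \<le> \<delta>" "\<tau> \<le> \<delta>0" using \<delta> \<delta>0 by (auto simp: \<tau>_def)
    have "f2 * \<tau>^2 > 0" using \<open>f2 / 4 > 0\<close> \<tau> by simp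
    moreover have "\<bar>\<gamma> (t0 + \<tau>) $ 2 - h - f2 * \<tau>^2 / 2\<bar> \<le> f2 / 4 * \<tau>^2" using \<delta>(2) \<tau> by simp
    ultimately have "\<gamma> (t0 + \<tau>) $ 2 > h" by (simp only: abs_le_iff) linarith
    moreover have "\<gamma> (t0 + \<tau>) $ 2 \<le> h" using p(2) inK mem[of \<tau>] \<tau> by (auto simp: h_def)
    ultimately show False by simp
  qed
  define \<kappa> where "\<kappa> = - f2 / d^2"
  have \<kappa>: "\<kappa> > 0" using \<open>f2 < 0\<close> d unfolding \<kappa>_def by (intro divide_pos_pos) auto
  have cont: "continuous_on {t0 - \<delta>0..t0 + \<delta>0} (\<lambda>t. \<gamma> t $ 1)"
  proof (rule DERIV_continuous_on)
    fix t assume "t \<in> {t0 - \<delta>0..t0 + \<delta>0}"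
    then have "t \<in> I" using mem[of "t - t0"] by auto
    then show "((\<lambda>t. \<gamma> t $ 1) has_real_derivative vderiv 1 \<gamma> t $ 1) (at t within {t0 - \<delta>0..t0 + \<delta>0})"
      by (intro has_field_derivative_at_within[OF d1])
  qed
  have graph: "\<exists>\<eta>>0. \<forall>s. \<bar>s\<bar> \<le> \<eta> \<longrightarrow> (\<exists>y. pt (x0 + s) y \<in> frontier K \<and> \<bar>y - h + \<kappa> * s^2 / 2\<bar> \<le> e * s^2)"
    if e: "e > 0" for e
  proof -
    obtain \<eta> where \<eta>: "\<eta> > 0" "\<And>s. \<bar>s\<bar> \<le> \<eta> \<Longrightarrow> \<exists>\<tau>. \<bar>\<tau>\<bar> \<le> \<delta>0 \<and> \<gamma> (t0 + \<tau>) $ 1 = x0 + s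
            \<and> \<bar>\<gamma> (t0 + \<tau>) $ 2 - h + (- f2 / d^2) * s^2 / 2\<bar> \<le> e * s^2"
      using graph_of_curve_peano[OF P1 P2 d \<delta>0(1) cont e] by blast
    have "\<exists>y. pt (x0 + s) y \<in> frontier K \<and> \<bar>y - h + \<kappa> * s^2 / 2\<bar> \<le> e * s^2" if s: "\<bar>s\<bar> \<le> \<eta>" for s
    proof -
      obtain \<tau> where \<tau>: "\<bar>\<tau>\<bar> \<le> \<delta>0" "\<gamma> (t0 + \<tau>) $ 1 = x0 + s"
          "\<bar>\<gamma> (t0 + \<tau>) $ 2 - h + (- f2 / d^2) * s^2 / 2\<bar> \<le> e * s^2"
        using \<eta>(2)[OF s] by blast
      have "pt (x0 + s) (\<gamma> (t0 + \<tau>) $ 2) = \<gamma> (t0 + \<tau>)" unfolding \<tau>(2)[symmetric] by (rule pt_eta)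
      then show ?thesis using fr[OF mem[OF \<tau>(1)]] \<tau>(3) unfolding \<kappa>_def by metis
    qed
    then show ?thesis using \<eta>(1) by blast
  qed
  have x0: "- halfwidth < x0" "x0 < halfwidth"
  proof -
    obtain \<eta> where \<eta>: "\<eta> > 0" "\<And>s. \<bar>s\<bar> \<le> \<eta> \<Longrightarrow> \<exists>y. pt (x0 + s) y \<in> frontier K"
      using graph[OF zero_less_one] by blast
    have "x0 + s \<in> shadow" if "\<bar>s\<bar> \<le> \<eta>" for s
      using \<eta>(2)[OF that] cpt by (auto simp: mem_shadow slice_def frontier_def compact_imp_closed)
    from this[of \<eta>] this[of "- \<eta>"] show "- halfwidth < x0" "x0 < halfwidth" using \<eta>(1) by (auto simp: shadow_eq)
  qed
  obtain \<eta>1 where \<eta>1: "\<eta>1 > 0" "\<And>x y. \<lbrakk>\<bar>x - x0\<bar> \<le> \<eta>1; \<bar>y - h\<bar> \<le> \<eta>1; pt x y \<in> frontier K\<rbrakk> \<Longrightarrow> y = crest x"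
    using frontier_near_top[OF int h _ x0] p(2) unfolding h_def by blast
  have "\<exists>\<eta>>0. \<forall>s. \<bar>s\<bar> \<le> \<eta> \<longrightarrow> \<bar>crest (x0 + s) - h + \<kappa> * s^2 / 2\<bar> \<le> e * s^2" if e: "e > 0" for e
  proof -
    obtain \<eta>2 where \<eta>2: "\<eta>2 > 0" "\<And>s. \<bar>s\<bar> \<le> \<eta>2 \<Longrightarrow> \<exists>y. pt (x0 + s) y \<in> frontier K \<and> \<bar>y - h + \<kappa> * s^2 / 2\<bar> \<le> e * s^2"
      using graph[OF e] by blast
    define c where "c = e + \<kappa> / 2"
    have c: "c > 0" using e \<kappa> by (simp add: c_def)
    define \<eta> where "\<eta> = min (min 1 \<eta>2) (min \<eta>1 (\<eta>1 / c))"
    have \<eta>: "\<eta> > 0" "\<eta> \<le> 1" "\<eta> \<le> \<eta>2" "\<eta> \<le> \<eta>1" "\<eta> \<le> \<eta>1 / c" using \<eta>1 \<eta>2 c by (auto simp: \<eta>_def)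
    have "\<bar>crest (x0 + s) - h + \<kappa> * s^2 / 2\<bar> \<le> e * s^2" if s: "\<bar>s\<bar> \<le> \<eta>" for s
    proof -
      obtain y where y: "pt (x0 + s) y \<in> frontier K" "\<bar>y - h + \<kappa> * s^2 / 2\<bar> \<le> e * s^2"
        using \<eta>2(2)[of s] s \<eta> by auto
      have "s^2 \<le> \<eta>1 / c"
      proof -
        have "\<bar>s\<bar> * \<bar>s\<bar> \<le> 1 * (\<eta>1 / c)" using s \<eta> \<eta>1(1) c by (intro mult_mono) auto
        then show ?thesis by (simp add: power2_eq_square)
      qed
      then have "c * s^2 \<le> \<eta>1" using c by (simp add: field_simps)
      moreover have "c * s^2 = e * s^2 + \<kappa> * s^2 / 2" "0 \<le> \<kappa> * s^2"
        using \<kappa> by (simp_all add: c_def algebra_simps)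
      then have "\<bar>y - h\<bar> \<le> c * s^2" using y(2) by linarith
      ultimately have "y = crest (x0 + s)" using \<eta>1(2)[of "x0 + s" y] y(1) s \<eta> by auto
      then show ?thesis using y(2) by simp
    qed
    then show ?thesis using \<eta>(1) by blast
  qed
  then have "parabolic_peak crest x0 h \<kappa>" unfolding parabolic_peak_def by blast
  with x0 \<kappa> show ?thesis by (rule that)
qed

end

section \<open>The Fourier transform of a convex body\<close>

lemma exponential_cis: "exponential a x = cis (2 * pi * (x \<bullet> a))"
  by (simp add: exponential_def cis_conv_exp mult_ac)

lemma exponential_mult_cnj: "exponential a x * cnj (exponential b x) = exponential (a - b) x"
  by (simp add: exponential_cis cis_cnj cis_mult inner_diff_right algebra_simps)

lemma continuous_exponential: "continuous_on S (exponential a)"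
  unfolding exponential_def by (intro continuous_intros)

lemma integral_cis_interval_bound:
  fixes c w :: real
  assumes "w \<noteq> 0"
  shows "norm (LINT y|lborel. indicator {l..u} y *\<^sub>R cis (c + w * y)) \<le> 2 / \<bar>w\<bar>"
proof (cases "l \<le> u")
  case True
  have "(LINT y|lborel. indicator {l..u} y *\<^sub>R cis (c + w * y)) = - \<i> * cis (c + w * u) / of_real w - (- \<i> * cis (c + w * l) / of_real w)"
  proof (rule integral_FTC_Icc[OF True])
    fix y
    have "((\<lambda>z. - \<i> * exp (\<i> * (of_real c + of_real w * z)) / of_real w) has_field_derivative exp (\<i> * (of_real c + of_real w * of_real y))) (at (of_real y))"
      using assms by (auto intro!: derivative_eq_intros)
    then have "((\<lambda>y. - \<i> * cis (c + w * y) / of_real w) has_vector_derivative cis (c + w * y)) (at y)"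
      using has_vector_derivative_real_field[of "\<lambda>z. - \<i> * exp (\<i> * (of_real c + of_real w * z)) / of_real w"]
      by (simp add: cis_conv_exp o_def)
    then show "((\<lambda>y. - \<i> * cis (c + w * y) / of_real w) has_vector_derivative cis (c + w * y)) (at y within {l..u})"
      by (rule has_vector_derivative_at_within)
  qed (intro continuous_intros)
  also have "norm \<dots> \<le> 1 / \<bar>w\<bar> + 1 / \<bar>w\<bar>"
    by (rule order_trans[OF norm_triangle_ineq4]) (simp add: norm_divide norm_mult)
  finally show ?thesis by simp
qed simp

lemma compact_convex_real_interval:
  fixes T :: "real set"
  assumes "compact T" "convex T"
  shows "\<exists>l u. T = {l..u}"
  using connected_compact_interval_1[of T] assms convex_connected by blast

lemma norm_integral_bounded_support:
  fixes f :: "real \<Rightarrow> complex"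
  assumes "\<And>x. norm (f x) \<le> indicator {-B..B} x * D" "B \<ge> 0" "D \<ge> 0"
  shows "norm (LINT x|lborel. f x) \<le> 2 * B * D"
proof -
  have "norm (LINT x|lborel. f x) \<le> (LINT x|lborel. norm (f x))" by (rule integral_norm_bound)
  also have "\<dots> \<le> (LINT x|lborel. indicator {-B..B} x * D)"
    using assms(2,3) by (intro integral_mono' assms(1)) auto
  also have "\<dots> = 2 * B * D" using assms(2) by simp
  finally show ?thesis .
qed

context symmetric_convex_plane
begin

definition transform :: "real^2 \<Rightarrow> complex" where
  "transform v = (LINT x|lebesgue_on K. exponential v x)"

abbreviation area :: real where "area \<equiv> measure lebesgue K"

lemma K_lmeasurable: "K \<in> lmeasurable"
  using cpt by (rule lmeasurable_compact)

lemma integrable_exponential: "integrable (lebesgue_on K) (exponential v)"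
  by (rule integral_plane_slices(3)[OF cpt continuous_exponential])

lemma Re_transform: "Re (transform v) = (LINT x|lebesgue_on K. cos (2 * pi * (x \<bullet> v)))"
  unfolding transform_def by (subst integral_Re[symmetric, OF integrable_exponential]) (simp add: exponential_cis)

lemma integral_const_K: "(LINT x|lebesgue_on K. (c::'b::euclidean_space)) = area *\<^sub>R c"
  using K_lmeasurable by (simp add: measure_restrict_space space_restrict_space fmeasurable_def)

lemma transform_0: "transform 0 = of_real area"
proof -
  have "exponential 0 = (\<lambda>_. 1)" by (auto simp: exponential_def)
  then show ?thesis
    unfolding transform_def by (simp only: integral_const_K) (simp add: scaleR_conv_of_real)
qed

lemma transform_minus: "transform (- v) = cnj (transform v)"
proof -
  have "exponential (- v) = (\<lambda>x. cnj (exponential v x))"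
    by (auto simp: exponential_cis cis_cnj)
  then show ?thesis unfolding transform_def by simp
qed

lemma area_pos: assumes "interior K \<noteq> {}" shows "area > 0"
proof -
  have "\<not> negligible K" using assms negligible_convex_interior[OF cvx] by simp
  then have "area \<noteq> 0" using K_lmeasurable by (simp add: negligible_iff_measure0)
  then show ?thesis using measure_nonneg[of lebesgue K] by linarith
qed

text \<open>
  If \<open>\<bar>v\<bar>\<close> is small against the diameter of \<open>K\<close>, the angle \<open>2 \<pi> (x \<bullet> v)\<close> stays below \<open>\<pi> / 3\<close> in
  absolute value, and the real part of the integrand is at least \<open>1/2\<close>.
\<close>
lemma transform_nonzero_near_0:
  assumes "interior K \<noteq> {}"
  obtains \<delta> where "\<delta> > 0" "\<And>v. norm v < \<delta> \<Longrightarrow> transform v \<noteq> 0"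
proof -
  obtain B where B: "B > 0" "\<And>x. x \<in> K \<Longrightarrow> norm x \<le> B"
    using compact_imp_bounded[OF cpt] by (auto simp: bounded_pos)
  show ?thesis
  proof (rule that[of "1 / (6 * B)"])
    show "1 / (6 * B) > 0" using B by simp
    fix v :: "real^2" assume v: "norm v < 1 / (6 * B)"
    have "1 / 2 \<le> cos (2 * pi * (x \<bullet> v))" if "x \<in> K" for x
    proof -
      have "\<bar>x \<bullet> v\<bar> \<le> norm x * norm v" by (rule Cauchy_Schwarz_ineq2)
      also have "\<dots> \<le> B * (1 / (6 * B))" using B(2)[OF that] v B(1) by (intro mult_mono) auto
      also have "\<dots> = 1 / 6" using B(1) by simp
      finally have "2 * pi * \<bar>x \<bullet> v\<bar> \<le> 2 * pi * (1 / 6)" by (intro mult_left_mono) auto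
      then have "\<bar>2 * pi * (x \<bullet> v)\<bar> \<le> pi / 3" by (simp add: abs_mult)
      then have "cos (pi / 3) \<le> cos \<bar>2 * pi * (x \<bullet> v)\<bar>" by (intro cos_monotone_0_pi_le) auto
      then show ?thesis by (simp add: cos_60)
    qed
    then have "(LINT x|lebesgue_on K. (1/2 :: real)) \<le> (LINT x|lebesgue_on K. cos (2 * pi * (x \<bullet> v)))"
      using K_lmeasurable by (intro integral_mono integral_plane_slices(3)[OF cpt]) (auto intro!: continuous_intros simp: space_restrict_space)
    then have "area / 2 \<le> Re (transform v)" using integral_const_K[of "1/2 :: real"] by (simp add: Re_transform)
    then show "transform v \<noteq> 0" using area_pos[OF assms] by auto
  qed
qed

text \<open>
  Lines parallel to the \<open>i\<close>-th axis meet \<open>K\<close> in segments, on which the exponential integrates to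
  \<open>O(1 / \<bar>v $ i\<bar>)\<close>; only a bounded range of such lines meets \<open>K\<close>.
\<close>
lemma transform_decay:
  obtains B where "\<And>v i. \<bar>v $ i\<bar> * norm (transform v) \<le> B"
proof -
  obtain B where B: "B > 0" "\<And>x. x \<in> K \<Longrightarrow> norm x \<le> B"
    using compact_imp_bounded[OF cpt] by (auto simp: bounded_pos)
  have coords: "\<bar>x\<bar> \<le> B \<and> \<bar>y\<bar> \<le> B" if "pt x y \<in> K" for x y
    using B(2)[OF that] component_le_norm_cart[of "pt x y" 1] component_le_norm_cart[of "pt x y" 2] by simp
  have "\<bar>v $ i\<bar> * norm (transform v) \<le> 2 * B * 2" for v i
  proof (cases "v $ i = 0")
    case False
    define w where "w = 2 * pi * v $ i"
    have w: "w \<noteq> 0" "\<bar>v $ i\<bar> \<le> \<bar>w\<bar>" using False pi_gt3 by (auto simp: w_def abs_mult)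
    have slice_bound: "norm (LINT y|lborel. indicator T y *\<^sub>R cis (c + w * y)) \<le> 2 / \<bar>w\<bar>"
      if "compact T" "convex T" for T c
      using compact_convex_real_interval[OF that] integral_cis_interval_bound[OF w(1)] by auto
    have line_section: "compact T \<and> convex T"
      if T: "T = (\<lambda>t. a + t *\<^sub>R axis j (1::real)) -` K" for T and a :: "real^2" and j
    proof
      show "convex T" unfolding convex_def
      proof (intro ballI allI impI)
        fix s t p q :: real assume *: "s \<in> T" "t \<in> T" "0 \<le> p" "0 \<le> q" "p + q = 1"
        have "p *\<^sub>R (a + s *\<^sub>R axis j 1) + q *\<^sub>R (a + t *\<^sub>R axis j 1) \<in> K"
          using * cvx by (auto simp: T convex_def)
        also have "p *\<^sub>R (a + s *\<^sub>R axis j 1) + q *\<^sub>R (a + t *\<^sub>R axis j 1) = (p + q) *\<^sub>R a + (p * s + q * t) *\<^sub>R axis j 1"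
          by (simp add: algebra_simps)
        finally show "p *\<^sub>R s + q *\<^sub>R t \<in> T" using * by (simp add: T)
      qed
      have "closed T" unfolding T
        by (intro continuous_closed_vimage compact_imp_closed[OF cpt] continuous_intros)
      moreover have "bounded T"
      proof (rule boundedI)
        fix t assume "t \<in> T"
        then have "norm (t *\<^sub>R axis j (1::real) :: real^2) \<le> norm (a + t *\<^sub>R axis j 1) + norm a" "norm (a + t *\<^sub>R axis j 1) \<le> B"
          using norm_triangle_ineq4[of "a + t *\<^sub>R axis j 1" a] B(2) by (auto simp: T)
        then show "norm t \<le> B + norm a" by simp
      qed
      ultimately show "compact T" by (simp add: compact_eq_bounded_closed)
    qed
    have "norm (transform v) \<le> 2 * B * (2 / \<bar>w\<bar>)"
    proof (cases "i = 2")
      case True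
      have "transform v = (LINT x|lborel. LINT y|lborel. indicator K (pt x y) *\<^sub>R exponential v (pt x y))"
        unfolding transform_def by (rule integral_plane_slices(1)[OF cpt continuous_exponential])
      also have "norm \<dots> \<le> 2 * B * (2 / \<bar>w\<bar>)"
      proof (rule norm_integral_bounded_support)
        fix x
        let ?T = "(\<lambda>t. pt x 0 + t *\<^sub>R axis 2 1) -` K"
        have "y \<in> ?T \<longleftrightarrow> pt x y \<in> K" for y by (simp add: pt_def)
        then have ind: "indicator ?T y = (indicator K (pt x y) :: real)" for y by (simp add: indicator_def)
        have "(LINT y|lborel. indicator K (pt x y) *\<^sub>R exponential v (pt x y))
            = (LINT y|lborel. indicator ?T y *\<^sub>R cis (2 * pi * v $ 1 * x + w * y))"
          by (intro Bochner_Integration.integral_cong)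
            (auto simp: ind exponential_cis inner_real2 w_def True algebra_simps)
        also have "norm \<dots> \<le> 2 / \<bar>w\<bar>"
          using line_section[of ?T "pt x 0" 2] by (intro slice_bound) auto
        finally have inside: "norm (LINT y|lborel. indicator K (pt x y) *\<^sub>R exponential v (pt x y)) \<le> 2 / \<bar>w\<bar>" .
        show "norm (LINT y|lborel. indicator K (pt x y) *\<^sub>R exponential v (pt x y)) \<le> indicator {-B..B} x * (2 / \<bar>w\<bar>)"
        proof (cases "\<bar>x\<bar> \<le> B")
          case True
          then show ?thesis using inside by (simp add: indicator_def abs_le_iff)
        next
          case False
          then have "indicator K (pt x y) = (0::real)" for y using coords[of x] by (auto simp: indicator_def)
          then show ?thesis using False by simp
        qed
      qed (use B in auto)
      finally show ?thesis .
    next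
      case False
      then have i: "i = 1" using exhaust_2[of i] by blast
      have "transform v = (LINT y|lborel. LINT x|lborel. indicator K (pt x y) *\<^sub>R exponential v (pt x y))"
        unfolding transform_def by (rule integral_plane_slices(2)[OF cpt continuous_exponential])
      also have "norm \<dots> \<le> 2 * B * (2 / \<bar>w\<bar>)"
      proof (rule norm_integral_bounded_support)
        fix y
        let ?T = "(\<lambda>t. pt 0 y + t *\<^sub>R axis 1 1) -` K"
        have "x \<in> ?T \<longleftrightarrow> pt x y \<in> K" for x by (simp add: pt_def add.commute)
        then have ind: "indicator ?T x = (indicator K (pt x y) :: real)" for x by (simp add: indicator_def)
        have "(LINT x|lborel. indicator K (pt x y) *\<^sub>R exponential v (pt x y))
            = (LINT x|lborel. indicator ?T x *\<^sub>R cis (2 * pi * v $ 2 * y + w * x))"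
          by (intro Bochner_Integration.integral_cong)
            (auto simp: ind exponential_cis inner_real2 w_def i algebra_simps)
        also have "norm \<dots> \<le> 2 / \<bar>w\<bar>"
          using line_section[of ?T "pt 0 y" 1] by (intro slice_bound) auto
        finally have inside: "norm (LINT x|lborel. indicator K (pt x y) *\<^sub>R exponential v (pt x y)) \<le> 2 / \<bar>w\<bar>" .
        show "norm (LINT x|lborel. indicator K (pt x y) *\<^sub>R exponential v (pt x y)) \<le> indicator {-B..B} y * (2 / \<bar>w\<bar>)"
        proof (cases "\<bar>y\<bar> \<le> B")
          case True
          then show ?thesis using inside by (simp add: indicator_def abs_le_iff)
        next
          case False
          then have "indicator K (pt x y) = (0::real)" for x using coords[of _ y] by (auto simp: indicator_def)
          then show ?thesis using False by simp
        qed
      qed (use B in auto)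
      finally show ?thesis .
    qed
    then have "\<bar>v $ i\<bar> * norm (transform v) \<le> \<bar>w\<bar> * (2 * B * (2 / \<bar>w\<bar>))"
      using w by (intro mult_mono) auto
    also have "\<dots> = 2 * B * 2" using w by simp
    finally show ?thesis .
  qed (use B in auto)
  then show ?thesis using that by blast
qed

text \<open>
  Bessel's inequality: expand the square, use orthogonality, and complete the square in each coefficient
  \<open>c a\<close> separately.
\<close>
lemma approximation_error:
  assumes F: "finite F" and orth: "\<And>a b. \<lbrakk>a \<in> F; b \<in> F; a \<noteq> b\<rbrakk> \<Longrightarrow> transform (a - b) = 0" and "area > 0"
  shows "(LINT x|lebesgue_on K. (cmod (exponential \<xi> x - (\<Sum>a\<in>F. c a * exponential a x)))\<^sup>2)
    \<ge> area - (\<Sum>a\<in>F. (cmod (transform (\<xi> - a)))\<^sup>2) / area"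
proof -
  let ?M = "lebesgue_on K"
  let ?f = "exponential \<xi>" and ?g = "\<lambda>x. \<Sum>a\<in>F. c a * exponential a x"
  define T where "T = (\<lambda>a. transform (\<xi> - a))"
  have expand: "of_real ((cmod (?f x - ?g x))\<^sup>2) = exponential 0 x - (\<Sum>a\<in>F. cnj (c a) * exponential (\<xi> - a) x)
      - (\<Sum>a\<in>F. c a * exponential (a - \<xi>) x) + (\<Sum>a\<in>F. \<Sum>b\<in>F. c a * cnj (c b) * exponential (a - b) x)" for x
  proof -
    have "of_real ((cmod (?f x - ?g x))\<^sup>2) = (?f x - ?g x) * cnj (?f x - ?g x)"
      by (rule complex_norm_square)
    also have "\<dots> = ?f x * cnj (?f x) - (\<Sum>a\<in>F. cnj (c a) * (?f x * cnj (exponential a x)))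
        - (\<Sum>a\<in>F. c a * (exponential a x * cnj (?f x)))
        + (\<Sum>a\<in>F. \<Sum>b\<in>F. c a * cnj (c b) * (exponential a x * cnj (exponential b x)))"
      by (simp add: algebra_simps sum_distrib_left sum_distrib_right sum_product) (rule sum.swap)
    finally show ?thesis by (simp only: exponential_mult_cnj diff_self)
  qed
  have int: "integrable ?M (\<lambda>x. k * exponential v x)" for k v
    using integrable_exponential[of v] by simp
  have tr: "(LINT x|?M. k * exponential v x) = k * transform v" for k v
    by (simp add: transform_def)
  have "of_real (LINT x|?M. (cmod (?f x - ?g x))\<^sup>2) = (LINT x|?M. of_real ((cmod (?f x - ?g x))\<^sup>2) :: complex)"
    by (rule integral_complex_of_real[symmetric])
  also have "\<dots> = transform 0 - (\<Sum>a\<in>F. cnj (c a) * T a) - (\<Sum>a\<in>F. c a * transform (a - \<xi>))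
      + (\<Sum>a\<in>F. \<Sum>b\<in>F. c a * cnj (c b) * transform (a - b))"
    unfolding expand using int integrable_exponential
    by (simp add: tr T_def integrable_exponential transform_def[symmetric])
  also have "(\<Sum>a\<in>F. \<Sum>b\<in>F. c a * cnj (c b) * transform (a - b)) = (\<Sum>a\<in>F. c a * cnj (c a) * of_real area)"
  proof (rule sum.cong[OF refl])
    fix a assume "a \<in> F"
    have "(\<Sum>b\<in>F. c a * cnj (c b) * transform (a - b)) = (\<Sum>b\<in>F. if b = a then c a * cnj (c a) * of_real area else 0)"
      using orth[OF \<open>a \<in> F\<close>] by (intro sum.cong) (auto simp: transform_0)
    then show "(\<Sum>b\<in>F. c a * cnj (c b) * transform (a - b)) = c a * cnj (c a) * of_real area"
      using F \<open>a \<in> F\<close> by simp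
  qed
  also have "(\<Sum>a\<in>F. c a * transform (a - \<xi>)) = (\<Sum>a\<in>F. c a * cnj (T a))"
    using transform_minus[of "\<xi> - _"] by (simp add: T_def)
  finally have "(LINT x|?M. (cmod (?f x - ?g x))\<^sup>2) = Re (transform 0 - (\<Sum>a\<in>F. cnj (c a) * T a)
     - (\<Sum>a\<in>F. c a * cnj (T a)) + (\<Sum>a\<in>F. c a * cnj (c a) * of_real area))"
    by (metis Re_complex_of_real)
  also have "\<dots> = area + (\<Sum>a\<in>F. area * (cmod (c a))\<^sup>2 - 2 * Re (cnj (c a) * T a))"
  proof -
    have "Re (c a * cnj (c a) * of_real area) = area * (cmod (c a))\<^sup>2" for a
      by (simp add: complex_norm_square[symmetric] del: of_real_power)
    moreover have "Re (c a * cnj (T a)) = Re (cnj (c a) * T a)" for a by simp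
    ultimately show ?thesis
      by (simp add: transform_0 sum_subtractf sum.distrib sum_distrib_left sum_negf Re_sum del: times_complex.sel)
  qed
  also have "\<dots> \<ge> area + (\<Sum>a\<in>F. - ((cmod (T a))\<^sup>2 / area))"
  proof (intro add_left_mono sum_mono)
    fix a
    have "Re (cnj (c a) * T a) \<le> cmod (c a) * cmod (T a)"
      using complex_Re_le_cmod[of "cnj (c a) * T a"] by (simp add: norm_mult)
    moreover have "0 \<le> (area * cmod (c a) - cmod (T a))\<^sup>2 / area" using \<open>area > 0\<close> by simp
    moreover have "(area * cmod (c a) - cmod (T a))\<^sup>2 / area = area * (cmod (c a))\<^sup>2 - 2 * (cmod (c a) * cmod (T a)) + (cmod (T a))\<^sup>2 / area"
      using \<open>area > 0\<close> by (simp add: power2_eq_square field_simps)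
    ultimately show "- ((cmod (T a))\<^sup>2 / area) \<le> area * (cmod (c a))\<^sup>2 - 2 * Re (cnj (c a) * T a)" by linarith
  qed
  finally show ?thesis by (simp add: T_def sum_negf sum_divide_distrib)
qed

end

section \<open>Counting in sparse planar sets\<close>

definition square :: "real \<Rightarrow> (real^2) set" where
  "square q = {v. \<forall>i. v $ i \<in> {-q..q}}"

lemma mem_square: "v \<in> square q \<longleftrightarrow> \<bar>v $ 1\<bar> \<le> q \<and> \<bar>v $ 2\<bar> \<le> q"
  by (auto simp: square_def forall_2 abs_le_iff)

text \<open>
  Cut the plane into cells of side \<open>\<delta> / 2\<close>: two points of a common cell have distance less than
  \<open>\<delta>\<close>, so the points are counted by the cells that meet the rectangle.
\<close>
lemma separated_in_rectangle:
  fixes A :: "(real^2) set"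
  assumes "\<delta> > 0" and sep: "\<And>a b. \<lbrakk>a \<in> A; b \<in> A; a \<noteq> b\<rbrakk> \<Longrightarrow> \<delta> \<le> norm (a - b)"
    and rect: "\<And>a. a \<in> A \<Longrightarrow> x \<le> a $ 1 \<and> a $ 1 \<le> x + l \<and> y \<le> a $ 2 \<and> a $ 2 \<le> y + h"
  shows "finite A" and "card A \<le> nat (\<lceil>2 * l / \<delta>\<rceil> + 1) * nat (\<lceil>2 * h / \<delta>\<rceil> + 1)"
proof -
  define f where "f = (\<lambda>t::real. \<lfloor>2 * t / \<delta>\<rfloor>)"
  have close: "\<bar>s - t\<bar> < \<delta> / 2" if "f s = f t" for s t
  proof -
    have "\<bar>2 * s / \<delta> - 2 * t / \<delta>\<bar> < 1"
      using that floor_correct[of "2 * s / \<delta>"] floor_correct[of "2 * t / \<delta>"] unfolding f_def by linarith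
    moreover have "2 * s / \<delta> - 2 * t / \<delta> = 2 * (s - t) / \<delta>" by (simp add: diff_divide_distrib right_diff_distrib)
    ultimately have "\<bar>s * 2 - t * 2\<bar> < \<delta>" using \<open>\<delta> > 0\<close> by (simp add: field_simps)
    then show ?thesis by linarith
  qed
  define F where "F = (\<lambda>v::real^2. (f (v $ 1), f (v $ 2)))"
  have inj: "inj_on F A"
  proof (rule inj_onI, rule ccontr)
    fix a b assume ab: "a \<in> A" "b \<in> A" "F a = F b" "a \<noteq> b"
    have "norm (a - b) \<le> \<bar>(a - b) $ 1\<bar> + \<bar>(a - b) $ 2\<bar>"
      using norm_le_l1_cart[of "a - b"] by (simp add: sum_2)
    also have "\<dots> < \<delta> / 2 + \<delta> / 2"
      using ab(3) close by (intro add_strict_mono) (auto simp: F_def)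
    finally show False using sep[OF ab(1,2,4)] by simp
  qed
  have range: "f t \<in> {f s..f s + \<lceil>2 * w / \<delta>\<rceil>}" if "s \<le> t" "t \<le> s + w" for s t w
  proof -
    have "f s \<le> f t" unfolding f_def using that \<open>\<delta> > 0\<close> by (intro floor_mono divide_right_mono) auto
    moreover have "2 * t / \<delta> \<le> 2 * s / \<delta> + 2 * w / \<delta>"
      using that \<open>\<delta> > 0\<close> by (simp add: field_simps)
    then have "f t \<le> f s + \<lceil>2 * w / \<delta>\<rceil>" unfolding f_def by linarith
    ultimately show ?thesis by simp
  qed
  let ?B = "{f x..f x + \<lceil>2 * l / \<delta>\<rceil>} \<times> {f y..f y + \<lceil>2 * h / \<delta>\<rceil>}"
  have sub: "F ` A \<subseteq> ?B"
  proof
    fix z assume "z \<in> F ` A"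
    then obtain a where "a \<in> A" "z = F a" by blast
    then show "z \<in> ?B" using rect[of a] range[of x "a $ 1" l] range[of y "a $ 2" h]
      unfolding F_def by blast
  qed
  show "finite A" using sub inj by (meson finite_SigmaI finite_atLeastAtMost_int finite_imageD finite_subset)
  have "card A = card (F ` A)" using inj by (simp add: card_image)
  also have "\<dots> \<le> card ?B" using sub by (intro card_mono) auto
  also have "\<dots> = nat (\<lceil>2 * l / \<delta>\<rceil> + 1) * nat (\<lceil>2 * h / \<delta>\<rceil> + 1)"
    by (simp add: card_cartesian_product algebra_simps)
  finally show "card A \<le> nat (\<lceil>2 * l / \<delta>\<rceil> + 1) * nat (\<lceil>2 * h / \<delta>\<rceil> + 1)" .
qed

definition separated :: "real \<Rightarrow> (real^2) set \<Rightarrow> bool" where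
  "separated \<delta> A \<longleftrightarrow> (\<forall>a\<in>A. \<forall>b\<in>A. a \<noteq> b \<longrightarrow> \<delta> \<le> norm (a - b))"

text \<open>
  The configuration excluded by the additivity of phases; the width \<open>1\<close> is the range of first coordinates
  on which the stationary phase estimate will be uniform.
\<close>
definition tall_triple_free :: "real \<Rightarrow> (real^2) set \<Rightarrow> bool" where
  "tall_triple_free R A \<longleftrightarrow> (\<forall>a\<in>A. \<forall>b\<in>A. \<forall>c\<in>A.
     \<bar>b $ 1 - a $ 1\<bar> \<le> 1 \<longrightarrow> \<bar>c $ 1 - b $ 1\<bar> \<le> 1 \<longrightarrow> \<bar>c $ 1 - a $ 1\<bar> \<le> 1 \<longrightarrow>
     R \<le> b $ 2 - a $ 2 \<longrightarrow> \<not> R \<le> c $ 2 - b $ 2)"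

text \<open>
  The points in one strip lie in two windows of height \<open>R\<close>: the first starts at the lowest point \<open>a\<close> of
  the strip, the second at the lowest point \<open>b\<close> above the first window, and a point above both
  windows would complete a forbidden triple with \<open>a\<close> and \<open>b\<close>.
\<close>
lemma linear_growth:
  assumes "\<delta> > 0" "R > 0"
  obtains C :: real where "C \<ge> 0"
    "\<And>A q. \<lbrakk>separated \<delta> A; tall_triple_free R A; 1 \<le> q\<rbrakk>
       \<Longrightarrow> finite (A \<inter> square q) \<and> real (card (A \<inter> square q)) \<le> C * q"
proof -
  define N where "N = nat (\<lceil>2 * 1 / \<delta>\<rceil> + 1) * nat (\<lceil>2 * R / \<delta>\<rceil> + 1)"
  have main: "finite (A \<inter> square q) \<and> real (card (A \<inter> square q)) \<le> (8 * real N) * q"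
    if "separated \<delta> A" and "tall_triple_free R A" and "1 \<le> q" for A q
  proof -
    have sep: "\<delta> \<le> norm (a - b)" if "a \<in> A" "b \<in> A" "a \<noteq> b" for a b
      using \<open>separated \<delta> A\<close> that by (auto simp: separated_def)
    note triple = \<open>tall_triple_free R A\<close>[unfolded tall_triple_free_def, rule_format]
    let ?S = "A \<inter> square q"
    have fin: "finite ?S"
      by (rule separated_in_rectangle[OF \<open>\<delta> > 0\<close>, of _ "-q" "2 * q" "-q" "2 * q"])
        (use sep in \<open>auto simp: mem_square\<close>)
    have window: "card B \<le> N" if "B \<subseteq> A" "\<And>v. v \<in> B \<Longrightarrow> x \<le> v $ 1 \<and> v $ 1 \<le> x + 1 \<and> y \<le> v $ 2 \<and> v $ 2 \<le> y + R" for B x y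
      unfolding N_def
    proof (rule separated_in_rectangle(2)[OF \<open>\<delta> > 0\<close>])
      show "\<delta> \<le> norm (a - b)" if "a \<in> B" "b \<in> B" "a \<noteq> b" for a b
        using sep \<open>B \<subseteq> A\<close> that by blast
    qed (rule that(2))
    have strip: "card B \<le> 2 * N" if B: "B \<subseteq> A" "finite B" "\<And>v. v \<in> B \<Longrightarrow> x \<le> v $ 1 \<and> v $ 1 \<le> x + 1" for B x
    proof (cases "B = {}")
      case False
      define a where "a = arg_min_on (\<lambda>v. v $ 2) B"
      have a: "a \<in> B" "\<And>v. v \<in> B \<Longrightarrow> a $ 2 \<le> v $ 2"
        using arg_min_if_finite(1)[OF \<open>finite B\<close> False] arg_min_least[OF \<open>finite B\<close> False]
        by (auto simp: a_def)
      define B1 where "B1 = {v \<in> B. v $ 2 \<le> a $ 2 + R}"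
      define B2 where "B2 = {v \<in> B. a $ 2 + R < v $ 2}"
      have "card B1 \<le> N" using B a by (intro window[of _ x "a $ 2"]) (auto simp: B1_def)
      moreover have "card B2 \<le> N"
      proof (cases "B2 = {}")
        case False
        have "finite B2" using B by (auto simp: B2_def)
        define b where "b = arg_min_on (\<lambda>v. v $ 2) B2"
        have b: "b \<in> B2" "\<And>v. v \<in> B2 \<Longrightarrow> b $ 2 \<le> v $ 2"
          using arg_min_if_finite(1)[OF \<open>finite B2\<close> False] arg_min_least[OF \<open>finite B2\<close> False]
          by (auto simp: b_def)
        have "v $ 2 \<le> b $ 2 + R" if "v \<in> B2" for v
        proof (rule ccontr)
          assume "\<not> ?thesis"
          moreover have "a \<in> B" "b \<in> B" "v \<in> B" using a b that by (auto simp: B2_def)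
          ultimately show False
            using triple[of a b v] B(1) B(3)[of a] B(3)[of b] B(3)[of v] b(1) that by (force simp: B2_def)
        qed
        then show ?thesis using B b by (intro window[of _ x "b $ 2"]) (auto simp: B2_def)
      qed simp
      moreover have "B = B1 \<union> B2" by (auto simp: B1_def B2_def)
      ultimately show ?thesis using card_Un_le[of B1 B2] by simp
    qed simp
    define n where "n = \<lceil>q\<rceil>"
    define T where "T = (\<lambda>k::int. {v \<in> ?S. real_of_int k \<le> v $ 1 \<and> v $ 1 \<le> real_of_int k + 1})"
    have "?S \<subseteq> (\<Union>k\<in>{-n..<n}. T k)"
    proof
      fix v assume v: "v \<in> ?S"
      then have "\<bar>v $ 1\<bar> \<le> q" by (simp add: mem_square)
      then have "\<bar>v $ 1\<bar> \<le> real_of_int n" unfolding n_def by linarith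
      show "v \<in> (\<Union>k\<in>{-n..<n}. T k)"
      proof (cases "v $ 1 = real_of_int n")
        case True
        have "n \<ge> 1" using \<open>1 \<le> q\<close> unfolding n_def by linarith
        then show ?thesis using v True by (intro UN_I[of "n - 1"]) (auto simp: T_def)
      next
        case False
        then show ?thesis using v \<open>\<bar>v $ 1\<bar> \<le> real_of_int n\<close>
          by (intro UN_I[of "\<lfloor>v $ 1\<rfloor>"]) (auto simp: T_def floor_less_iff le_floor_iff abs_le_iff)
      qed
    qed
    moreover have finT: "finite (T k)" for k
      using fin by (rule rev_finite_subset) (auto simp: T_def)
    ultimately have "card ?S \<le> card (\<Union>k\<in>{-n..<n}. T k)"
      by (intro card_mono) auto
    also have "\<dots> \<le> (\<Sum>k\<in>{-n..<n}. card (T k))" by (rule card_UN_le) simp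
    also have "\<dots> \<le> (\<Sum>k\<in>{-n..<n}. 2 * N)"
    proof (rule sum_mono)
      fix k show "card (T k) \<le> 2 * N"
        using finT[of k] by (intro strip[of _ "real_of_int k"]) (auto simp: T_def)
    qed
    also have "\<dots> = nat (2 * n) * (2 * N)" by simp
    finally have "real (card ?S) \<le> real (nat (2 * n)) * (2 * real N)"
      by (metis of_nat_le_iff of_nat_mult of_nat_numeral)
    also have "\<dots> \<le> (4 * q) * (2 * real N)"
    proof (rule mult_right_mono)
      have "real_of_int n \<le> q + 1" "n \<ge> 1" unfolding n_def using \<open>1 \<le> q\<close> by linarith+
      then show "real (nat (2 * n)) \<le> 4 * q" using \<open>1 \<le> q\<close> by simp
    qed simp
    finally show ?thesis using fin by (simp add: mult_ac)
  qed
  show ?thesis by (rule that[of "8 * real N"]) (simp, rule main)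
qed

text \<open>
  Otherwise each of the \<open>n\<^sup>2\<close> points of a grid of mesh \<open>3 r\<close> has its own point of \<open>A\<close> within distance
  \<open>r\<close>, which produces \<open>n\<^sup>2\<close> points of \<open>A\<close> in a square of side \<open>O(n r)\<close>.
\<close>
lemma hole_in_sparse_set:
  fixes A :: "(real^2) set"
  assumes sparse: "\<And>q. q \<ge> 1 \<Longrightarrow> finite (A \<inter> square q) \<and> real (card (A \<inter> square q)) \<le> C * q"
    and r: "r \<ge> 1"
  shows "\<exists>\<xi>. \<forall>a\<in>A. a - \<xi> \<notin> square r"
proof (rule ccontr)
  assume no: "\<nexists>\<xi>. \<forall>a\<in>A. a - \<xi> \<notin> square r"
  obtain n :: nat where n: "real n > C * 3 * r" "n \<ge> 1"
    using reals_Archimedean2[of "max 1 (C * 3 * r)"] by (metis less_le_trans max.strict_boundedE max_less_iff_conj of_nat_1 of_nat_less_iff order_less_imp_le)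
  define p where "p = (\<lambda>(i::nat, j::nat). pt (3 * r * real i) (3 * r * real j))"
  have "\<forall>z. \<exists>a. a \<in> A \<and> a - p z \<in> square r" using no by blast
  then obtain f where f: "\<And>z. f z \<in> A" "\<And>z. f z - p z \<in> square r" by metis
  let ?G = "{..<n} \<times> {..<n}"
  have apart: "i = i'" if "\<bar>w - 3 * r * real i\<bar> \<le> r" "\<bar>w - 3 * r * real i'\<bar> \<le> r" for w i i'
  proof -
    have "\<bar>3 * r * real i - 3 * r * real i'\<bar> \<le> 2 * r" using that by linarith
    moreover have "\<bar>3 * r * real i - 3 * r * real i'\<bar> = 3 * r * \<bar>real i - real i'\<bar>"
      using r by (simp add: abs_mult flip: right_diff_distrib)
    ultimately have "\<bar>real i - real i'\<bar> < 1" using r by (simp add: field_simps)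
    then show ?thesis by linarith
  qed
  have inj: "inj_on f ?G"
  proof (rule inj_onI, clarify)
    fix i j i' j' assume eq: "f (i, j) = f (i', j')"
    show "i = i' \<and> j = j'"
      using f(2)[of "(i, j)"] f(2)[of "(i', j')"] apart[of "f (i, j) $ 1" i i'] apart[of "f (i, j) $ 2" j j'] eq
      by (simp add: mem_square p_def)
  qed
  have sub: "f ` ?G \<subseteq> A \<inter> square (3 * r * real n)"
  proof
    fix z assume "z \<in> f ` ?G"
    then obtain i j where ij: "i < n" "j < n" "z = f (i, j)" by auto
    have b: "\<bar>w\<bar> \<le> 3 * r * real n" if "\<bar>w - 3 * r * real k\<bar> \<le> r" "k < n" for w and k :: nat
    proof -
      have "3 * r * (real k + 1) \<le> 3 * r * real n" using r that by (intro mult_left_mono) auto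
      moreover have "3 * r * real k \<ge> 0" using r by simp
      moreover have "3 * r * (real k + 1) = 3 * r * real k + 3 * r" by (simp add: algebra_simps)
      ultimately show ?thesis using that(1) r by linarith
    qed
    show "z \<in> A \<inter> square (3 * r * real n)"
      using f[of "(i, j)"] b[of "f (i, j) $ 1" i] b[of "f (i, j) $ 2" j] ij by (simp add: mem_square p_def)
  qed
  have q: "3 * r * real n \<ge> 1" using r n mult_mono[of 1 "3 * r" 1 "real n"] by simp
  have "real n * real n = real (card (f ` ?G))" using inj by (simp add: card_image card_cartesian_product)
  also have "\<dots> \<le> real (card (A \<inter> square (3 * r * real n)))"
    using sub sparse[OF q] by (simp add: card_mono)
  also have "\<dots> \<le> C * (3 * r * real n)" using sparse[OF q] by simp
  also have "\<dots> = (C * 3 * r) * real n" by simp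
  also have "\<dots> < real n * real n" using n by (intro mult_strict_right_mono) auto
  finally show False by simp
qed

text \<open>
  The shell between the squares of half sides \<open>2^J r\<close> and \<open>2^(J + 1) r\<close> contains \<open>O(2^J r)\<close> points, each
  contributing \<open>O(1 / (2^J r)\<^sup>2)\<close>; the shells sum up geometrically.
\<close>
lemma sparse_inverse_square_sum:
  fixes A F :: "(real^2) set"
  assumes sparse: "\<And>q. q \<ge> 1 \<Longrightarrow> finite (A \<inter> square q) \<and> real (card (A \<inter> square q)) \<le> C * q"
    and r: "r \<ge> 1" "C \<ge> 0" and far: "\<And>a. a \<in> A \<Longrightarrow> a \<notin> square r" and F: "finite F" "F \<subseteq> A"
    and \<psi>: "\<And>v q. \<lbrakk>q > 0; v \<notin> square q\<rbrakk> \<Longrightarrow> \<psi> v \<le> (B / q)^2" "\<And>v. \<psi> v \<ge> 0"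
  shows "(\<Sum>a\<in>F. \<psi> a) \<le> 4 * C * B^2 / r"
proof -
  have ind: "(\<Sum>a\<in>F \<inter> square (2^J * r). \<psi> a) \<le> 4 * C * B^2 / r * (1 - 1 / 2^J)" for J
  proof (induction J)
    case 0
    have "F \<inter> square r = {}" using far F by auto
    then show ?case by simp
  next
    case (Suc J)
    let ?Q = "2^J * r"
    have Q: "?Q \<ge> 1" using r mult_mono[of 1 "2^J" 1 r] by simp
    have "F \<inter> square (2^Suc J * r) = (F \<inter> square ?Q) \<union> (F \<inter> (square (2 * ?Q) - square ?Q))"
      using Q by (auto simp: mem_square)
    then have "(\<Sum>a\<in>F \<inter> square (2^Suc J * r). \<psi> a) = (\<Sum>a\<in>F \<inter> square ?Q. \<psi> a) + (\<Sum>a\<in>F \<inter> (square (2 * ?Q) - square ?Q). \<psi> a)"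
      using F by (simp only:) (intro sum.union_disjoint, auto)
    moreover have "(\<Sum>a\<in>F \<inter> (square (2 * ?Q) - square ?Q). \<psi> a) \<le> 4 * C * B^2 / r * (1 / 2^Suc J)"
    proof -
      have "(\<Sum>a\<in>F \<inter> (square (2 * ?Q) - square ?Q). \<psi> a) \<le> real (card (F \<inter> (square (2 * ?Q) - square ?Q))) * (B / ?Q)^2"
        using Q \<psi>(1) by (intro sum_bounded_above) auto
      also have "\<dots> \<le> (C * (2 * ?Q)) * (B / ?Q)^2"
      proof (rule mult_right_mono)
        have "card (F \<inter> (square (2 * ?Q) - square ?Q)) \<le> card (A \<inter> square (2 * ?Q))"
          using sparse[of "2 * ?Q"] Q F by (intro card_mono) auto
        then show "real (card (F \<inter> (square (2 * ?Q) - square ?Q))) \<le> C * (2 * ?Q)"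
          using sparse[of "2 * ?Q"] Q by linarith
      qed simp
      also have "\<dots> = 4 * C * B^2 / r * (1 / 2^Suc J)" using r by (simp add: field_simps power2_eq_square)
      finally show ?thesis .
    qed
    moreover have "4 * C * B^2 / r * (1 - 1 / 2^J) + 4 * C * B^2 / r * (1 / 2^Suc J) = 4 * C * B^2 / r * (1 - 1 / 2^Suc J)"
    proof -
      have "(1 - 1 / 2^J) + 1 / 2^Suc J = (1 - 1 / 2^Suc J :: real)" by (simp add: field_simps)
      then show ?thesis by (simp only: distrib_left[symmetric])
    qed
    ultimately show ?case using Suc.IH by linarith
  qed
  have "\<exists>J. \<forall>a\<in>F. a \<in> square (2^J * r)"
  proof -
    define b where "b = Max (insert 0 ((\<lambda>a. max \<bar>a $ 1\<bar> \<bar>a $ 2\<bar>) ` F))"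
    obtain J :: nat where J: "b < 2^J" using real_arch_pow[of 2 b] by auto
    have "a \<in> square (2^J * r)" if "a \<in> F" for a
    proof -
      have "max \<bar>a $ 1\<bar> \<bar>a $ 2\<bar> \<le> b" unfolding b_def using F that by (intro Max_ge) auto
      moreover have "(2::real)^J * 1 \<le> 2^J * r" using r by (intro mult_left_mono) auto
      ultimately show ?thesis using J unfolding mem_square by linarith
    qed
    then show ?thesis by blast
  qed
  then obtain J where "F \<inter> square (2^J * r) = F" by blast
  then have "(\<Sum>a\<in>F. \<psi> a) \<le> 4 * C * B^2 / r * (1 - 1 / 2^J)" using ind[of J] by simp
  also have "\<dots> \<le> 4 * C * B^2 / r * 1" using r by (intro mult_left_mono) auto
  finally show ?thesis by simp
qed

section \<open>Orthogonal exponentials\<close>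

context symmetric_convex_plane
begin

definition orthogonal_spectrum :: "(real^2) set \<Rightarrow> bool" where
  "orthogonal_spectrum A \<longleftrightarrow> (\<forall>a\<in>A. \<forall>b\<in>A. a \<noteq> b \<longrightarrow> transform (a - b) = 0)"

text \<open>
  Three stacked points \<open>a\<close>, \<open>b\<close>, \<open>c\<close> provide the zeros \<open>b - a\<close>, \<open>c - b\<close> and their sum \<open>c - a\<close>
  of the transform, all in nearly vertical directions, and the leading phase \<open>\<alpha>\<close> of the transform is
  additive.
\<close>
lemma orthogonal_spectrum_tall_triple_free:
  assumes x0: "- halfwidth < x0" "x0 < halfwidth" and "\<kappa> > 0" and peak: "parabolic_peak crest x0 h \<kappa>"
  obtains R where "R > 0" "\<And>A. orthogonal_spectrum A \<Longrightarrow> tall_triple_free R A"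
proof -
  \<comment> \<open>The tolerance \<open>1 / 60\<close> satisfies \<open>5 / 60 < 1 / 10\<close>, the lower bound for the Fresnel integral.\<close>
  have pos: "(0::real) < 1 / 60" "0 \<le> 2 * pi" by auto
  obtain M \<Lambda> where M: "M \<ge> 1" and \<Lambda>: "\<Lambda> > 0" and
    est: "\<And>\<omega> c. \<lbrakk>\<omega> \<ge> \<Lambda>; \<bar>c\<bar> \<le> 2 * pi\<rbrakk> \<Longrightarrow>
      \<bar>sqrt (\<kappa> * \<omega> / 2) * integral {- halfwidth..halfwidth} (\<lambda>x. sin (c * x + \<omega> * crest x))
        - (integral {-M..M} (\<lambda>u. cos (u^2)) * sin (c * x0 + \<omega> * h)
           - integral {-M..M} (\<lambda>u. sin (u^2)) * cos (c * x0 + \<omega> * h))\<bar> \<le> 1 / 60"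
    using concave_stationary_phase[OF crest_concave[unfolded shadow_eq] x0 \<open>\<kappa> > 0\<close> pos peak] by blast
  define \<alpha> where "\<alpha> = (\<lambda>v::real^2. 2 * pi * v $ 1 * x0 + 2 * pi * v $ 2 * h)"
  have key: "\<bar>integral {-M..M} (\<lambda>u. cos (u^2)) * sin (\<alpha> v) - integral {-M..M} (\<lambda>u. sin (u^2)) * cos (\<alpha> v)\<bar> \<le> 1 / 60"
    if v: "\<bar>v $ 1\<bar> \<le> 1" "\<Lambda> \<le> v $ 2" and z: "transform v = 0" for v
  proof -
    have "v $ 2 > 0" using \<open>\<Lambda> > 0\<close> v by linarith
    have "\<bar>2 * pi * v $ 1\<bar> \<le> 2 * pi" using v by (simp add: abs_mult)
    moreover have "1 * v $ 2 \<le> 2 * pi * v $ 2" using \<open>v $ 2 > 0\<close> pi_gt3 by (intro mult_right_mono) auto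
    then have "\<Lambda> \<le> 2 * pi * v $ 2" using v by simp
    moreover have "(LINT x|lebesgue_on K. cos (2 * pi * (x \<bullet> pt (v $ 1) (v $ 2)))) = 0"
      using Re_transform[of v] z by simp
    then have "integral {- halfwidth..halfwidth} (\<lambda>x. sin (2 * pi * v $ 1 * x + 2 * pi * v $ 2 * crest x)) = 0"
      using cosine_transform_eq[OF \<open>v $ 2 > 0\<close>, of "v $ 1"] \<open>v $ 2 > 0\<close> by simp
    ultimately show ?thesis using est[of "2 * pi * v $ 2" "2 * pi * v $ 1"] by (simp add: \<alpha>_def abs_minus_commute)
  qed
  have "tall_triple_free \<Lambda> A" if A: "orthogonal_spectrum A" for A
    unfolding tall_triple_free_def
  proof (intro ballI impI notI)
    fix a b c assume *: "a \<in> A" "b \<in> A" "c \<in> A" "\<bar>b $ 1 - a $ 1\<bar> \<le> 1" "\<bar>c $ 1 - b $ 1\<bar> \<le> 1"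
      "\<bar>c $ 1 - a $ 1\<bar> \<le> 1" "\<Lambda> \<le> b $ 2 - a $ 2" "\<Lambda> \<le> c $ 2 - b $ 2"
    have zero: "transform (q - p) = 0" if "p \<in> A" "q \<in> A" "\<Lambda> \<le> q $ 2 - p $ 2" for p q
    proof -
      have "q \<noteq> p" using that \<Lambda> by auto
      then show ?thesis using A that unfolding orthogonal_spectrum_def by blast
    qed
    have ac: "\<Lambda> \<le> c $ 2 - a $ 2" using * \<Lambda> by linarith
    have "\<alpha> (b - a) + \<alpha> (c - b) = \<alpha> (c - a)" by (simp add: \<alpha>_def algebra_simps)
    then have "integral {-M..M} (\<lambda>u::real. sin (u^2)) \<le> 5 * (1 / 60)"
      using key[of "b - a"] key[of "c - b"] key[of "c - a"] zero[of a b] zero[of b c] zero[of a c] * ac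
      by (intro no_additive_triple[of _ "\<alpha> (b - a)" _ _ "\<alpha> (c - b)"]) simp_all
    then show False using fresnel_sine_lower[OF M] by simp
  qed
  with \<Lambda> show ?thesis using that by blast
qed

lemma orthogonal_spectrum_separated:
  assumes "interior K \<noteq> {}"
  obtains \<delta> where "\<delta> > 0" "\<And>A. orthogonal_spectrum A \<Longrightarrow> separated \<delta> A"
proof -
  obtain \<delta> where \<delta>: "\<delta> > 0" "\<And>v. norm v < \<delta> \<Longrightarrow> transform v \<noteq> 0"
    using transform_nonzero_near_0[OF assms] by blast
  have "separated \<delta> A" if "orthogonal_spectrum A" for A
    unfolding separated_def
  proof (intro ballI impI, rule ccontr)
    fix a b assume "a \<in> A" "b \<in> A" "a \<noteq> b" "\<not> \<delta> \<le> norm (a - b)"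
    moreover from this have "norm (a - b) < \<delta>" by simp
    ultimately show False using that \<delta>(2) unfolding orthogonal_spectrum_def by blast
  qed
  with \<delta>(1) show ?thesis using that by blast
qed

lemma orthogonal_spectrum_linear_growth:
  assumes smooth: "smooth_plane_curve (frontier K)" and curved: "nonvanishing_curvature (frontier K)"
  obtains C where "C \<ge> 0"
    "\<And>A q. \<lbrakk>orthogonal_spectrum A; 1 \<le> q\<rbrakk> \<Longrightarrow> finite (A \<inter> square q) \<and> real (card (A \<inter> square q)) \<le> C * q"
proof -
  obtain \<delta> where \<delta>: "\<delta> > 0" "\<And>A. orthogonal_spectrum A \<Longrightarrow> separated \<delta> A"
    using orthogonal_spectrum_separated[OF nonempty_interior[OF assms]] by blast
  obtain x0 h \<kappa> where x0: "- halfwidth < x0" "x0 < halfwidth" and \<kappa>: "\<kappa> > 0"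
    and peak: "parabolic_peak crest x0 h \<kappa>"
    using curved_top[OF assms] by blast
  obtain R where R: "R > 0" "\<And>A. orthogonal_spectrum A \<Longrightarrow> tall_triple_free R A"
    using orthogonal_spectrum_tall_triple_free[OF x0 \<kappa> peak] by blast
  obtain C where C: "C \<ge> 0" "\<And>A q. \<lbrakk>separated \<delta> A; tall_triple_free R A; 1 \<le> q\<rbrakk>
       \<Longrightarrow> finite (A \<inter> square q) \<and> real (card (A \<inter> square q)) \<le> C * q"
    using linear_growth[OF \<delta>(1) R(1)] by blast
  show ?thesis using that[OF C(1)] C(2) \<delta>(2) R(2) by blast
qed

lemma exponential_in_L2: "exponential \<xi> \<in> L2_space (lebesgue_on K)"
proof -
  have "integrable (lebesgue_on K) (\<lambda>x. (cmod (exponential \<xi> x))\<^sup>2)"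
    using integral_plane_slices(3)[OF cpt, of "\<lambda>_. 1 :: real"] by (simp add: exponential_cis)
  then show ?thesis using integrable_exponential[of \<xi>] by (simp add: L2_space_def)
qed

text \<open>
  At a point \<open>\<xi>\<close> far from \<open>A\<close> the coefficients \<open>transform (\<xi> - a)\<close> are so small in total that no
  combination of the exponentials from \<open>A\<close> comes closer to \<open>exponential \<xi>\<close> than
  \<open>sqrt (3 area / 4)\<close>.
\<close>
lemma no_orthogonal_basis:
  assumes smooth: "smooth_plane_curve (frontier K)" and curved: "nonvanishing_curvature (frontier K)"
  shows "\<not> orthogonal_basis_L2 (lebesgue_on K) A exponential"
proof
  assume basis: "orthogonal_basis_L2 (lebesgue_on K) A exponential"
  obtain C where C: "C \<ge> 0" and sparse:
    "\<And>A q. \<lbrakk>orthogonal_spectrum A; 1 \<le> q\<rbrakk> \<Longrightarrow> finite (A \<inter> square q) \<and> real (card (A \<inter> square q)) \<le> C * q"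
    using orthogonal_spectrum_linear_growth[OF assms] by blast
  obtain B where B: "\<And>v i. \<bar>v $ i\<bar> * norm (transform v) \<le> B" using transform_decay by blast
  have area: "area > 0" using area_pos nonempty_interior[OF assms] by blast
  have orth: "orthogonal_spectrum A"
    using basis unfolding orthogonal_spectrum_def orthogonal_basis_L2_def L2_inner_def
    by (simp add: exponential_mult_cnj transform_def)
  \<comment> \<open>The distance at which the coefficients have total square at most \<open>area\<^sup>2 / 4\<close>.\<close>
  define r where "r = max 1 (16 * C * B\<^sup>2 / area\<^sup>2)"
  have r: "r \<ge> 1" "16 * C * B\<^sup>2 / area\<^sup>2 \<le> r" by (auto simp: r_def)
  then have r': "4 * C * B\<^sup>2 / r \<le> area\<^sup>2 / 4" using area by (simp add: field_simps)
  obtain \<xi> where \<xi>: "\<And>a. a \<in> A \<Longrightarrow> a - \<xi> \<notin> square r"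
    using hole_in_sparse_set[of A C r] sparse[OF orth] r(1) by blast
  let ?\<psi> = "\<lambda>v. (cmod (transform v))\<^sup>2"
  have orth': "orthogonal_spectrum ((\<lambda>a. a - \<xi>) ` A)"
    using orth by (auto simp: orthogonal_spectrum_def)
  have decay: "?\<psi> v \<le> (B / q)\<^sup>2" if q: "q > 0" and v: "v \<notin> square q" for v q
  proof (rule power_mono)
    obtain i where "q < \<bar>v $ i\<bar>" using v by (auto simp: mem_square not_le)
    then have "q * cmod (transform v) \<le> \<bar>v $ i\<bar> * cmod (transform v)" by (intro mult_right_mono) auto
    also have "\<dots> \<le> B" by (rule B)
    finally show "cmod (transform v) \<le> B / q" using \<open>q > 0\<close> by (simp add: field_simps)
  qed simp
  have "sqrt (area / 2) > 0" using area by simp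
  then obtain F c where F: "finite F" "F \<subseteq> A" and
      close: "L2_norm (lebesgue_on K) (\<lambda>x. exponential \<xi> x - (\<Sum>a\<in>F. c a * exponential a x)) < sqrt (area / 2)"
    using basis exponential_in_L2[of \<xi>] unfolding orthogonal_basis_L2_def by meson
  have "(\<Sum>a\<in>F. ?\<psi> (\<xi> - a)) = (\<Sum>v\<in>(\<lambda>a. a - \<xi>) ` F. ?\<psi> v)"
    using transform_minus[of "_ - \<xi>"] by (subst sum.reindex) (auto simp: inj_on_def)
  also have "\<dots> \<le> 4 * C * B\<^sup>2 / r"
    using sparse_inverse_square_sum[OF sparse[OF orth'] r(1) C, of "(\<lambda>a. a - \<xi>) ` F" ?\<psi> B] \<xi> F decay by auto
  also note r'
  finally have "(\<Sum>a\<in>F. ?\<psi> (\<xi> - a)) / area \<le> area / 4"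
    using area by (simp add: field_simps power2_eq_square)
  moreover have "area - (\<Sum>a\<in>F. ?\<psi> (\<xi> - a)) / area
      \<le> (LINT x|lebesgue_on K. (cmod (exponential \<xi> x - (\<Sum>a\<in>F. c a * exponential a x)))\<^sup>2)"
    using orth F by (intro approximation_error area) (auto simp: orthogonal_spectrum_def)
  moreover have "\<dots> < area / 2" using close by (simp add: L2_norm_def)
  ultimately show False using area by linarith
qed

end

theorem theorem1p4:
  fixes K :: "(real^2) set"
  assumes "K \<noteq> {}" and "compact K" and "convex K"
    and "\<forall>x\<in>K. - x \<in> K"
    and "smooth_plane_curve (frontier K)"
    and "nonvanishing_curvature (frontier K)"
  shows "(\<exists>C::real. \<forall>A::(real^2) set.
            (\<forall>a\<in>A. \<forall>a'\<in>A. a \<noteq> a' \<longrightarrow> (LINT x|lebesgue_on K. exponential (a - a') x) = 0) \<longrightarrow>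
            (\<forall>q::real. q \<ge> 1 \<longrightarrow>
               finite (A \<inter> {x. \<forall>i. x $ i \<in> {-q..q}}) \<and>
               real (card (A \<inter> {x. \<forall>i. x $ i \<in> {-q..q}})) \<le> C * q)) \<and>
         \<not> (\<exists>A::(real^2) set. orthogonal_basis_L2 (lebesgue_on K) A exponential)"
proof -
  interpret symmetric_convex_plane K
  proof
    show "- v \<in> K" if "v \<in> K" for v using assms(4) that by blast
  qed (rule assms)+
  obtain C where "\<And>A q. \<lbrakk>orthogonal_spectrum A; 1 \<le> q\<rbrakk>
      \<Longrightarrow> finite (A \<inter> square q) \<and> real (card (A \<inter> square q)) \<le> C * q"
    using orthogonal_spectrum_linear_growth[OF assms(5,6)] by blast
  then show ?thesis
    using no_orthogonal_basis[OF assms(5,6)]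
    unfolding orthogonal_spectrum_def transform_def square_def by blast
qed

end
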